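(* Assume that (i) $Q$ is self-adjoint and positive definite; (ii) $\mathcal M\succeq 0$; (iii) the operator $G:=\partial\Phi+P+\sigma A^\top A$ has a single-valued inverse $G^{-1}:\mathbb R^n\to\mathbb R^n$ that is globally Lipschitz continuous. Assume moreover that $\mathcal T^{-1}(0)\neq\emptyset$ and $\gamma\in(-1,1)$. Let $w^0\in\mathbb R^n\times\mathbb R^m$ and let $\{w^k\},\{\hat w^k\},\{\bar w^k\}$ be generated, for $k\ge 0$, by $$\hat w^k=\widehat{\mathcal T}(w^k),\qquad \bar w^k=(1+\gamma)\hat w^k-\gamma w^k,\qquad w^{k+1}=\frac{1}{k+2}w^0+\frac{k+1}{k+2}\bar w^k ,$$ where $\widehat{\mathcal T}=(\mathcal M+\mathcal T)^{-1}\mathcal M$. Write $\hat w^k=(\hat x^k,\hat y^k)$. Then $\{w^k\}$ and $\{\hat w^k\}$ converge strongly to a common limit $w^\ast=(x^\ast,y^\ast)\in\mathcal T^{-1}(0)=\mathcal R^{-1}(0)$. Moreover, for every $k\ge 0$, $$r_{\mathrm{KKT}}(\hat w^k)\le \frac{2\|\mathcal E_\sigma\|\sqrt{\|\mathcal M\|}}{(1+\gamma)(k+1)}\,\mathrm{dist}_{\mathcal M}\bigl(w^0,\mathcal T^{-1}(0)\bigr),$$ so $r_{\mathrm{KKT}}(\hat w^k)=O(1/k)$. Furthermore, with $$C_\ast:=\sup_{k\ge0}\bigl(\|\hat x^k-x^\ast\|+\|\hat y^k\|\bigr)+\|y^\ast\|,$$ one has $C_\ast<\infty$ and $$\bigl|\Phi(\hat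 x^k)-\Phi(x^\ast)\bigr|\le C_\ast\, r_{\mathrm{KKT}}(\hat w^k),\qquad k\ge0 .$$ In particular $|\Phi(\hat x^k)-\Phi(x^\ast)|=O(1/k)$.
   Context: Setting: $A\in\mathbb R^{m\times n}$, $b\in\mathbb R^m$, $\sigma\ge0$; $f:\mathbb R^n\to\mathbb R$ is convex and continuously differentiable with Lipschitz continuous gradient; $g:\mathbb R^n\to(-\infty,+\infty]$ is proper, closed and convex; $\Phi:=f+g$. The problem $\min_x\Phi(x)$ s.t. $Ax=b$ is assumed to have a nonempty feasible set and at least one optimal solution. $P\in\mathbb R^{n\times n}$ and $Q\in\mathbb R^{m\times m}$ are self-adjoint positive semidefinite. For $w=(x,y)\in\mathbb R^n\times\mathbb R^m$ define $$\mathcal M=\begin{pmatrix} P & A^\top \\ A & Q \end{pmatrix},\qquad \mathcal T(x,y)=\begin{pmatrix} \partial\Phi(x)-A^\top y+\sigma A^\top(Ax-b) \\ Ax-b \end{pmatrix},$$ $$\mathcal R(x,y)=\begin{pmatrix} \nabla f(x)+\partial g(x)-A^\top y \\ Ax-b \end{pmatrix},\qquad r_{\mathrm{KKT}}(x,y)=\mathrm{dist}\bigl(0,\mathcal R(x,y)\bigr),$$ ($\mathcal T,\mathcal R$ are set-valued) and the linear map $\mathcal E_\sigma(u,v)=(u-\sigma A^\top v,v)$. Under (i)–(iii) the resolvent $(\mathcal M+\mathcal T)^{-1}$ is single-valued and everywhere defined. Notation: $\|w\|_{\mathcal M}=\sqrt{\langle w,\mathcal Mw\rangle}$ (a seminorm),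 $\mathrm{dist}_{\mathcal M}(w,S)=\inf_{u\in S}\|w-u\|_{\mathcal M}$; other norms are Euclidean/operator norms and $\mathrm{dist}$ is Euclidean distance. *)

theory Defs
  imports "HOL-Analysis.Analysis" "HOL-Library.Landau_Symbols"
begin

definition epi :: "('a \<Rightarrow> ereal) \<Rightarrow> ('a \<times> real) set" where
  "epi g = {(x, t). g x \<le> ereal t}"

definition proper_closed_convex :: "('a::real_normed_vector \<Rightarrow> ereal) \<Rightarrow> bool" where
  "proper_closed_convex g \<longleftrightarrow>
     (\<forall>x. g x \<noteq> -\<infinity>) \<and> (\<exists>x. g x \<noteq> \<infinity>) \<and> closed (epi g) \<and> convex (epi g)"

text \<open>The subdifferential is empty outside the effective domain.\<close>

definition subdiff :: "('a::real_inner \<Rightarrow> ereal) \<Rightarrow> 'a \<Rightarrow> 'a set" where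
  "subdiff g x = {u. \<bar>g x\<bar> \<noteq> \<infinity> \<and> (\<forall>z. g x + ereal (u \<bullet> (z - x)) \<le> g z)}"

definition objective :: "('a \<Rightarrow> real) \<Rightarrow> ('a \<Rightarrow> ereal) \<Rightarrow> 'a \<Rightarrow> ereal" where
  "objective f g x = ereal (f x) + g x"

definition selfadjoint :: "('a::euclidean_space \<Rightarrow> 'a) \<Rightarrow> bool" where
  "selfadjoint L \<longleftrightarrow> linear L \<and> adjoint L = L"

definition pos_semidef :: "('a::euclidean_space \<Rightarrow> 'a) \<Rightarrow> bool" where
  "pos_semidef L \<longleftrightarrow> selfadjoint L \<and> (\<forall>x. 0 \<le> x \<bullet> L x)"

definition pos_def :: "('a::euclidean_space \<Rightarrow> 'a) \<Rightarrow> bool" where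
  "pos_def L \<longleftrightarrow> selfadjoint L \<and> (\<forall>x. x \<noteq> 0 \<longrightarrow> 0 < x \<bullet> L x)"

definition sv_inverse :: "('a \<Rightarrow> 'b set) \<Rightarrow> 'b \<Rightarrow> 'a set" where
  "sv_inverse F z = {x. z \<in> F x}"

definition has_lipschitz_inverse ::
    "('a::metric_space \<Rightarrow> 'b::metric_space set) \<Rightarrow> bool" where
  "has_lipschitz_inverse F \<longleftrightarrow>
     (\<exists>h L. (\<forall>z. sv_inverse F z = {h z}) \<and> L-lipschitz_on UNIV h)"

text \<open>The infimum is taken in the extended reals, so that the distance to the empty set
  is \<open>\<infinity>\<close> (in contrast to \<open>infdist\<close>, which is then \<open>0\<close>).\<close>

definition edist_set :: "'a::metric_space \<Rightarrow> 'a set \<Rightarrow> ereal" where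
  "edist_set w S = (INF u\<in>S. ereal (dist w u))"

definition seminorm_of :: "('a::real_inner \<Rightarrow> 'a) \<Rightarrow> 'a \<Rightarrow> real" where
  "seminorm_of L w = sqrt (w \<bullet> L w)"

definition semidist_set :: "('a::real_inner \<Rightarrow> 'a) \<Rightarrow> 'a \<Rightarrow> 'a set \<Rightarrow> ereal" where
  "semidist_set L w S = (INF u\<in>S. ereal (seminorm_of L (w - u)))"

text \<open>Matrices act by \<open>*v\<close>. The product type carries the Euclidean inner product and norm, so
  \<open>onorm\<close> is the spectral norm of the block operators below.\<close>

definition opM ::
    "real^'n^'n \<Rightarrow> real^'m^'m \<Rightarrow> real^'n^'m \<Rightarrow> (real^'n) \<times> (real^'m) \<Rightarrow> (real^'n) \<times> (real^'m)" where
  "opM P Q A = (\<lambda>(x, y). (P *v x + transpose A *v y, A *v x + Q *v y))"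

definition opE ::
    "real^'n^'m \<Rightarrow> real \<Rightarrow> (real^'n) \<times> (real^'m) \<Rightarrow> (real^'n) \<times> (real^'m)" where
  "opE A \<sigma> = (\<lambda>(u, v). (u - \<sigma> *\<^sub>R (transpose A *v v), v))"

definition opT ::
    "(real^'n \<Rightarrow> ereal) \<Rightarrow> real^'n^'m \<Rightarrow> real^'m \<Rightarrow> real
      \<Rightarrow> (real^'n) \<times> (real^'m) \<Rightarrow> ((real^'n) \<times> (real^'m)) set" where
  "opT \<Phi> A b \<sigma> = (\<lambda>(x, y).
     {(u - transpose A *v y + \<sigma> *\<^sub>R (transpose A *v (A *v x - b)), A *v x - b) | u.
        u \<in> subdiff \<Phi> x})"

definition opR ::
    "(real^'n \<Rightarrow> real^'n) \<Rightarrow> (real^'n \<Rightarrow> ereal) \<Rightarrow> real^'n^'m \<Rightarrow> real^'m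
      \<Rightarrow> (real^'n) \<times> (real^'m) \<Rightarrow> ((real^'n) \<times> (real^'m)) set" where
  "opR df g A b = (\<lambda>(x, y).
     {(df x + u - transpose A *v y, A *v x - b) | u. u \<in> subdiff g x})"

definition r_KKT ::
    "(real^'n \<Rightarrow> real^'n) \<Rightarrow> (real^'n \<Rightarrow> ereal) \<Rightarrow> real^'n^'m \<Rightarrow> real^'m
      \<Rightarrow> (real^'n) \<times> (real^'m) \<Rightarrow> ereal" where
  "r_KKT df g A b w = edist_set 0 (opR df g A b w)"

definition opG ::
    "(real^'n \<Rightarrow> ereal) \<Rightarrow> real^'n^'n \<Rightarrow> real^'n^'m \<Rightarrow> real \<Rightarrow> real^'n \<Rightarrow> (real^'n) set" where
  "opG \<Phi> P A \<sigma> x = {u + P *v x + \<sigma> *\<^sub>R (transpose A *v (A *v x)) | u. u \<in> subdiff \<Phi> x}"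

text \<open>\<open>(M + T)\<^sup>-\<^sup>1 M\<close> as a function: \<open>THE\<close> selects the element of the value of the set-valued
  inverse, which is meaningful whenever that value is a singleton.\<close>

definition resolvent_map ::
    "('a::plus \<Rightarrow> 'a) \<Rightarrow> ('a \<Rightarrow> 'a set) \<Rightarrow> 'a \<Rightarrow> 'a" where
  "resolvent_map M T w = (THE v. v \<in> sv_inverse (\<lambda>v. {M v + t | t. t \<in> T v}) (M w))"

end

theory Submission imports Defs begin

text \<open>In the semi-inner product \<open>\<langle>u, M v\<rangle>\<close> the resolvent map \<open>T\<close> is firmly nonexpansive, so
  \<open>R = (1 + \<gamma>) (I - T)\<close> satisfies \<open>|R u - R v|\<^sup>2 \<le> 2 \<langle>R u - R v, u - v\<rangle>\<close> and the iteration is the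
  Halpern iteration of the nonexpansive map \<open>I - R\<close>. By induction
  \<open>k |R w\<^sub>k|\<^sup>2 \<le> 2 \<langle>R w\<^sub>k, w\<^sub>0 - w\<^sub>k\<rangle>\<close>, and cocoercivity against a fixed point \<open>p\<close> turns this into
  \<open>(k + 1) |R w\<^sub>k| \<le> 2 |w\<^sub>0 - p|\<close>. Although \<open>M\<close> may be singular, \<open>T\<close> is Lipschitz from the seminorm
  to the Euclidean norm, because the resolvent is a Lipschitz function of \<open>M u\<close>. Hence the seminorm
  projection \<open>p\<close> of \<open>w\<^sub>0\<close> onto the fixed points exists, seminorm convergence of \<open>w\<^sub>k\<close> to \<open>p\<close> (Halpern's
  argument) gives \<open>T w\<^sub>k \<longlonglongrightarrow> p\<close> in norm, and \<open>w\<^sub>k \<longlonglongrightarrow> p\<close> follows since \<open>|\<gamma>| < 1\<close>. For the KKT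
  residual, \<open>M (w\<^sub>k - T w\<^sub>k)\<close> lies in the value of the monotone operator at \<open>T w\<^sub>k\<close>, and \<open>\<E>\<^sub>\<sigma>\<close> maps that
  value into the KKT operator's.\<close>

section \<open>Positive semidefinite operators\<close>

locale pos_semidef_operator =
  fixes M :: "'a::euclidean_space \<Rightarrow> 'a"
  assumes psd: "pos_semidef M"
begin

text \<open>Kept apart from the inner product of the type: \<open>M\<close> may be singular, so
  \<open>sip u u = 0\<close> does not force \<open>u = 0\<close>.\<close>

definition sip :: "'a \<Rightarrow> 'a \<Rightarrow> real" where
  "sip u v = u \<bullet> M v"

lemma linear_M: "linear M"
  using psd by (simp add: pos_semidef_def selfadjoint_def)

lemma sip_commute: "sip u v = sip v u"
proof -
  have "adjoint M = M" using psd by (simp add: pos_semidef_def selfadjoint_def)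
  then have "u \<bullet> M v = M u \<bullet> v"
    using adjoint_works[OF linear_M, of u v] by simp
  then show ?thesis by (simp add: sip_def inner_commute)
qed

lemma sip_ge_zero [simp]: "0 \<le> sip u u"
  using psd by (simp add: pos_semidef_def sip_def)

lemma sip_simps:
  "sip (u + v) x = sip u x + sip v x" "sip x (u + v) = sip x u + sip x v"
  "sip (u - v) x = sip u x - sip v x" "sip x (u - v) = sip x u - sip x v"
  "sip (a *\<^sub>R u) x = a * sip u x" "sip x (a *\<^sub>R u) = a * sip x u"
  "sip (- u) x = - sip u x" "sip x (- u) = - sip x u"
  "sip 0 x = 0" "sip x 0 = 0"
  by (simp_all add: sip_def inner_simps linear_add[OF linear_M] linear_diff[OF linear_M]
      linear_cmul[OF linear_M] linear_neg[OF linear_M] linear_0[OF linear_M])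

lemma seminorm_of_power2: "(seminorm_of M u)\<^sup>2 = sip u u"
  using sip_ge_zero[of u] by (simp add: seminorm_of_def sip_def)

lemma seminorm_of_ge_zero: "0 \<le> seminorm_of M u"
  using sip_ge_zero[of u] by (simp add: seminorm_of_def sip_def)

lemma two_sip_le: "2 * sip u v \<le> sip u u + sip v v"
  using sip_ge_zero[of "u - v"] sip_commute[of v u] unfolding sip_simps by simp

text \<open>Discriminant argument for a nonnegative quadratic in \<open>t\<close>, which becomes
  affine when \<open>sip u u = 0\<close>.\<close>

lemma sip_Cauchy_Schwarz_power2: "(sip u v)\<^sup>2 \<le> sip u u * sip v v"
proof -
  have quad: "0 \<le> sip u u * t\<^sup>2 + 2 * sip u v * t + sip v v" for t
    using sip_ge_zero[of "t *\<^sub>R u + v"]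
    by (simp add: sip_simps sip_commute[of v u] power2_eq_square algebra_simps)
  show ?thesis
  proof (cases "sip u u = 0")
    case True
    have "sip u v = 0"
    proof (rule ccontr)
      assume "sip u v \<noteq> 0"
      \<comment> \<open>This value of \<open>t\<close> would make the affine function equal to
        -1.\<close>
      then have "2 * sip u v * (- (sip v v + 1) / (2 * sip u v)) = - (sip v v + 1)"
        by (simp add: field_simps)
      with quad[of "- (sip v v + 1) / (2 * sip u v)"] True show False by simp
    qed
    with True show ?thesis by simp
  next
    case False
    then have pos: "0 < sip u u" using sip_ge_zero[of u] by linarith
    have "0 \<le> sip v v - (sip u v)\<^sup>2 / sip u u"
      using quad[of "- sip u v / sip u u"] pos by (simp add: power2_eq_square field_simps)
    with pos show ?thesis by (simp add: field_simps)
  qed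
qed

lemma sip_Cauchy_Schwarz: "sip u v \<le> seminorm_of M u * seminorm_of M v"
proof -
  have "\<bar>sip u v\<bar> \<le> sqrt (sip u u * sip v v)"
    using sip_Cauchy_Schwarz_power2 by (simp add: real_le_rsqrt)
  then show ?thesis
    by (simp add: seminorm_of_def sip_def real_sqrt_mult)
qed

lemma bounded_linear_M: "bounded_linear M"
  using linear_M linear_conv_bounded_linear by blast

text \<open>Cauchy-Schwarz for the pair \<open>M u\<close>, \<open>u\<close>, where
  \<open>sip (M u) u\<close> is the squared Euclidean norm of \<open>M u\<close>. This avoids a
  square root of \<open>M\<close>.\<close>

lemma norm_M_le: "norm (M u) \<le> sqrt (onorm M) * seminorm_of M u"
proof (cases "M u = 0")
  case True
  then show ?thesis
    using onorm_pos_le[OF bounded_linear_M] seminorm_of_ge_zero[of u] by simp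
next
  case False
  have "(norm (M u))\<^sup>2 = sip (M u) u"
    by (simp add: sip_def power2_norm_eq_inner)
  then have "((norm (M u))\<^sup>2)\<^sup>2 \<le> sip (M u) (M u) * sip u u"
    using sip_Cauchy_Schwarz_power2[of "M u" u] by simp
  also have "sip (M u) (M u) \<le> norm (M u) * norm (M (M u))"
    unfolding sip_def by (rule norm_cauchy_schwarz)
  also have "\<dots> \<le> norm (M u) * (onorm M * norm (M u))"
    by (intro mult_left_mono onorm[OF bounded_linear_M]) simp
  finally have "((norm (M u))\<^sup>2)\<^sup>2 \<le> (norm (M u))\<^sup>2 * (onorm M * sip u u)"
    by (simp add: power2_eq_square mult_right_mono algebra_simps)
  then have "(norm (M u))\<^sup>2 \<le> onorm M * sip u u"
    using False by (simp add: power2_eq_square)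
  then have "norm (M u) \<le> sqrt (onorm M * sip u u)"
    by (rule real_le_rsqrt)
  then show ?thesis
    by (simp add: seminorm_of_def sip_def real_sqrt_mult)
qed

lemma continuous_on_sip [continuous_intros]:
  "continuous_on S f \<Longrightarrow> continuous_on S g \<Longrightarrow> continuous_on S (\<lambda>x. sip (f x) (g x))"
  unfolding sip_def
  by (intro continuous_intros bounded_linear.continuous_on[OF bounded_linear_M])

lemma tendsto_sip [tendsto_intros]:
  "(f \<longlongrightarrow> a) F \<Longrightarrow> (g \<longlongrightarrow> b) F \<Longrightarrow> ((\<lambda>x. sip (f x) (g x)) \<longlongrightarrow> sip a b) F"
  unfolding sip_def
  by (intro tendsto_intros bounded_linear.tendsto[OF bounded_linear_M])

end

section \<open>Halpern iteration in a seminorm\<close>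

text \<open>With \<open>q = \<bar>\<gamma>\<bar>\<close> this turns convergence of
  \<open>T (w k)\<close> into convergence of \<open>w\<close> in norm: once \<open>d\<close> is
  small, unrolling the recursion leaves a geometric tail.\<close>

lemma tendsto_zero_contraction:
  fixes e d :: "nat \<Rightarrow> real"
  assumes "0 \<le> q" "q < 1" "\<And>k. 0 \<le> e k" "\<And>k. e (Suc k) \<le> d k + q * e k" "d \<longlonglongrightarrow> 0"
  shows "e \<longlonglongrightarrow> 0"
proof (rule LIMSEQ_I)
  fix r :: real
  assume "0 < r"
  \<comment> \<open>Chosen so that \<open>r / 2\<close> is the fixed point of the affine map with
    slope \<open>q\<close> and offset \<open>\<epsilon>\<close>.\<close>
  define \<epsilon> where "\<epsilon> = r * (1 - q) / 2"
  have \<epsilon>: "0 < \<epsilon>" using \<open>0 < r\<close> \<open>q < 1\<close> by (simp add: \<epsilon>_def)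
  then obtain N where N: "\<And>k. N \<le> k \<Longrightarrow> \<bar>d k\<bar> < \<epsilon>"
    using LIMSEQ_D[OF \<open>d \<longlonglongrightarrow> 0\<close>, of \<epsilon>] by auto
  have *: "e (N + j) \<le> r / 2 + q ^ j * e N" for j
  proof (induction j)
    case 0
    then show ?case using \<open>0 < r\<close> by simp
  next
    case (Suc j)
    have "e (N + Suc j) \<le> \<epsilon> + q * e (N + j)"
      using assms(4)[of "N + j"] N[of "N + j"] by simp
    also have "\<dots> \<le> \<epsilon> + q * (r / 2 + q ^ j * e N)"
      using Suc assms(1) by (simp add: mult_left_mono)
    also have "\<dots> = r / 2 + q ^ Suc j * e N"
      by (simp add: \<epsilon>_def algebra_simps) (simp add: field_simps)
    finally show ?case .
  qed
  have "(\<lambda>j. q ^ j * e N) \<longlonglongrightarrow> 0"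
    using tendsto_mult_left_zero[OF LIMSEQ_power_zero[of q]] assms(1,2) by simp
  then obtain J where J: "\<And>j. J \<le> j \<Longrightarrow> \<bar>q ^ j * e N\<bar> < r / 2"
    using LIMSEQ_D[of "\<lambda>j. q ^ j * e N" 0 "r / 2"] \<open>0 < r\<close> by auto
  have "norm (e k - 0) < r" if "N + J \<le> k" for k
  proof -
    have "N \<le> k" "J \<le> k - N" using that by simp_all
    then show ?thesis
      using *[of "k - N"] J[of "k - N"] assms(3)[of k] by (simp add: abs_less_iff)
  qed
  then show "\<exists>no. \<forall>k\<ge>no. norm (e k - 0) < r" by blast
qed

lemma bounded_contraction:
  fixes e :: "nat \<Rightarrow> real"
  assumes "0 \<le> q" "q < 1" "\<And>k. e (Suc k) \<le> c + q * e k"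
  shows "e k \<le> max (e 0) (c / (1 - q))"
proof (induction k)
  case 0
  show ?case by simp
next
  case (Suc k)
  let ?B = "max (e 0) (c / (1 - q))"
  have "c / (1 - q) \<le> ?B" by simp
  then have "c \<le> (1 - q) * ?B" using assms(2) by (simp add: field_simps del: max.cobounded2)
  moreover have "q * e k \<le> q * ?B" using Suc assms(1) by (simp add: mult_left_mono)
  ultimately show ?case using assms(3)[of k] by (simp add: algebra_simps)
qed

text \<open>\<open>firm\<close> is firm nonexpansiveness in the seminorm. \<open>lip\<close> makes
  up for a singular \<open>M\<close>: by it \<open>T u\<close> depends on \<open>u\<close> only
  modulo vectors of seminorm zero.\<close>

locale halpern_iteration = pos_semidef_operator +
  fixes T :: "'a \<Rightarrow> 'a" and K \<gamma> :: real and w :: "nat \<Rightarrow> 'a"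
  assumes firm: "\<And>u v. 0 \<le> sip ((u - v) - (T u - T v)) (T u - T v)"
    and lip: "\<And>u v. norm (T u - T v) \<le> K * seminorm_of M (u - v)"
    and fix_nonempty: "{u. T u = u} \<noteq> {}"
    and \<gamma>: "-1 < \<gamma>" "\<gamma> < 1"
    and step: "\<And>k. w (Suc k) = (1 / (real k + 2)) *\<^sub>R w 0
          + ((real k + 1) / (real k + 2)) *\<^sub>R ((1 + \<gamma>) *\<^sub>R T (w k) - \<gamma> *\<^sub>R w k)"
begin

section \<open>Residual of the relaxed map and its rate\<close>

abbreviation snorm :: "'a \<Rightarrow> real" where
  "snorm \<equiv> seminorm_of M"

text \<open>Scaled so that \<open>u - res u\<close> is the relaxed point
  \<open>(1 + \<gamma>) *\<^sub>R T u - \<gamma> *\<^sub>R u\<close>.\<close>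

definition res :: "'a \<Rightarrow> 'a" where
  "res u = (1 + \<gamma>) *\<^sub>R (u - T u)"

lemma step_res:
  "w (Suc k) = (1 / (real k + 2)) *\<^sub>R w 0 + ((real k + 1) / (real k + 2)) *\<^sub>R (w k - res (w k))"
  by (simp add: step res_def algebra_simps)

text \<open>Firmness gives cocoercivity of \<open>u - T u\<close> with constant 1, and
  \<open>1 + \<gamma> \<le> 2\<close> yields the factor 2. Equivalently, \<open>u - res u\<close> is
  nonexpansive in the seminorm.\<close>

lemma res_cocoercive: "sip (res u - res v) (res u - res v) \<le> 2 * sip (res u - res v) (u - v)"
proof -
  define D where "D = (u - v) - (T u - T v)"
  have D: "sip D D \<le> sip D (u - v)"
    using firm[of u v] by (simp add: D_def sip_simps)
  have R: "res u - res v = (1 + \<gamma>) *\<^sub>R D"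
    by (simp add: res_def D_def algebra_simps)
  have "(1 + \<gamma>) * sip D D \<le> 2 * sip D D"
    by (intro mult_right_mono) (use \<gamma> in auto)
  also have "\<dots> \<le> 2 * sip D (u - v)" using D by simp
  finally have "(1 + \<gamma>) * ((1 + \<gamma>) * sip D D) \<le> (1 + \<gamma>) * (2 * sip D (u - v))"
    by (intro mult_left_mono) (use \<gamma> in auto)
  then show ?thesis
    unfolding R by (simp only: sip_simps) (simp add: algebra_simps)
qed

lemma res_fixed: "T p = p \<Longrightarrow> res p = 0"
  by (simp add: res_def)

text \<open>The induction step is cocoercivity between \<open>w k\<close> and
  \<open>w (Suc k)\<close>; the Halpern weights are such that the induction hypothesis absorbs the
  remainder.\<close>

lemma residual_invariant:
  "real k * sip (res (w k)) (res (w k)) \<le> 2 * sip (res (w k)) (w 0 - w k)"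
proof (induction k)
  case 0
  show ?case by (simp add: sip_simps)
next
  case (Suc k)
  define r where "r = res (w k)"
  define r' where "r' = res (w (Suc k))"
  define d where "d = w 0 - w k"
  define c :: real where "c = real k + 2"
  have c: "0 < c" "real k = c - 2" by (simp_all add: c_def)
  have wS: "w (Suc k) = (1 / c) *\<^sub>R w 0 + ((c - 1) / c) *\<^sub>R (w k - r)"
    using step_res[of k] by (simp add: c_def r_def)
  have split: "(1 / c) *\<^sub>R x + ((c - 1) / c) *\<^sub>R x = x" for x :: 'a
    using c by (simp add: scaleR_add_left[symmetric] field_simps)
  have d': "w 0 - w (Suc k) = ((c - 1) / c) *\<^sub>R (d + r)"
    using split[of "w 0"] unfolding wS d_def by (simp add: algebra_simps)
  have "w k - w (Suc k) = ((c - 1) / c) *\<^sub>R r - (1 / c) *\<^sub>R d"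
    using split[of "w k"] unfolding wS d_def by (simp add: algebra_simps)
  then have diff: "w k - w (Suc k) = (1 / c) *\<^sub>R ((c - 1) *\<^sub>R r - d)"
    by (simp add: scaleR_diff_right)
  have "sip (r - r') (r - r') \<le> 2 * sip (r - r') (w k - w (Suc k))"
    using res_cocoercive[of "w k" "w (Suc k)"] by (simp add: r_def r'_def)
  then have "sip (r - r') (r - r') * c \<le> 2 * sip (r - r') ((c - 1) *\<^sub>R r - d)"
    using c unfolding diff sip_simps(6) by (simp add: field_simps)
  moreover have "(c - 2) * sip r r \<le> 2 * sip r d"
    using Suc by (simp add: c r_def d_def)
  \<comment> \<open>Expanding leaves \<open>(c - 2) * sip r r - 2 * sip r d\<close>, which is
    nonpositive by the induction hypothesis.\<close>
  ultimately have "c * sip r' r' \<le> 2 * sip r' (d + r)"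
    by (simp add: sip_simps sip_commute[of r' r] algebra_simps)
  then have "((c - 1) / c) * (c * sip r' r') \<le> ((c - 1) / c) * (2 * sip r' (d + r))"
    by (intro mult_left_mono) (auto simp: c_def)
  then have "(c - 1) * sip r' r' \<le> 2 * sip r' (w 0 - w (Suc k))"
    using c unfolding d' sip_simps(6) by (simp add: mult.commute mult.left_commute)
  then show ?case by (simp add: c_def r'_def algebra_simps)
qed

text \<open>Adding cocoercivity against \<open>p\<close> to the invariant cancels
  \<open>w k\<close>; Cauchy-Schwarz then allows one factor \<open>snorm r\<close> to be
  cancelled.\<close>

lemma residual_rate:
  assumes "T p = p"
  shows "(1 + \<gamma>) * (real k + 1) * snorm (w k - T (w k)) \<le> 2 * snorm (w 0 - p)"
proof -
  define r where "r = res (w k)"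
  have "sip r r \<le> 2 * sip r (w k - p)"
    using res_cocoercive[of "w k" p] by (simp add: res_fixed[OF assms] r_def)
  moreover have "real k * sip r r \<le> 2 * sip r (w 0 - w k)"
    using residual_invariant by (simp add: r_def)
  ultimately have "(real k + 1) * sip r r \<le> 2 * sip r (w 0 - p)"
    by (simp add: sip_simps algebra_simps)
  also have "\<dots> \<le> 2 * (snorm r * snorm (w 0 - p))"
    using sip_Cauchy_Schwarz by simp
  finally have "snorm r * ((real k + 1) * snorm r) \<le> snorm r * (2 * snorm (w 0 - p))"
    by (simp add: seminorm_of_power2[symmetric] power2_eq_square algebra_simps)
  then have "(real k + 1) * snorm r \<le> 2 * snorm (w 0 - p)"
    using seminorm_of_ge_zero[of r] seminorm_of_ge_zero[of "w 0 - p"]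
    by (cases "snorm r = 0") (auto simp: mult_le_cancel_left)
  moreover have "snorm r = (1 + \<gamma>) * snorm (w k - T (w k))"
    using \<gamma> by (simp add: seminorm_of_def r_def res_def linear_cmul[OF linear_M] real_sqrt_mult)
  ultimately show ?thesis by (simp add: algebra_simps)
qed

section \<open>Fixed points and the seminorm projection\<close>

lemma K_ge_zero_mult: "K * snorm u \<le> \<bar>K\<bar> * snorm u"
  using seminorm_of_ge_zero[of u] by (simp add: mult_right_mono)

text \<open>\<open>lip\<close> for the pair \<open>v\<close>, \<open>T v\<close> has right-hand side
  zero. While \<open>v\<close> itself may fail to be fixed, \<open>sip\<close> cannot tell it from
  the fixed point \<open>T v\<close>.\<close>

lemma fixed_of_snorm_zero:
  assumes "sip (v - T v) (v - T v) = 0"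
  shows "T (T v) = T v" "M (T v) = M v"
proof -
  have 0: "snorm (v - T v) = 0" using assms by (simp add: seminorm_of_def sip_def)
  then show "T (T v) = T v" using lip[of v "T v"] by simp
  show "M (T v) = M v" using norm_M_le[of "v - T v"] 0 by (simp add: linear_diff[OF linear_M])
qed

lemma continuous_on_T: "continuous_on UNIV T"
proof -
  have "(T \<longlongrightarrow> T v) (at v)" for v
  proof -
    have "((\<lambda>u. K * sqrt (sip (u - v) (u - v))) \<longlongrightarrow> K * sqrt (sip (v - v) (v - v))) (at v)"
      by (intro tendsto_intros)
    then have "((\<lambda>u. K * snorm (u - v)) \<longlongrightarrow> 0) (at v)"
      by (simp add: seminorm_of_def sip_def[symmetric] sip_simps(9))
    moreover have "\<forall>\<^sub>F u in at v. norm (T u - T v) \<le> K * snorm (u - v)"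
      using lip by simp
    ultimately have "((\<lambda>u. T u - T v) \<longlongrightarrow> 0) (at v)"
      by (rule Lim_null_comparison[rotated])
    then show ?thesis by (simp add: LIM_zero_iff)
  qed
  then show ?thesis by (simp add: continuous_on_def)
qed

text \<open>On fixed points the Euclidean distance is controlled by the seminorm, so the sublevel sets
  of the seminorm distance within the set of fixed points are compact even if \<open>M\<close> is singular.\<close>

lemma projection_exists:
  obtains p where "T p = p" "\<And>u. T u = u \<Longrightarrow> snorm (w 0 - p) \<le> snorm (w 0 - u)"
    "\<And>u. T u = u \<Longrightarrow> sip (w 0 - p) (u - p) \<le> 0"
proof -
  obtain q where q: "T q = q" using fix_nonempty by blast
  define d where "d u = sip (w 0 - u) (w 0 - u)" for u
  have cont_d: "continuous_on UNIV d" unfolding d_def by (intro continuous_intros)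
  define S where "S = {u. T u = u} \<inter> {u. d u \<le> d q}"
  have "closed S" unfolding S_def
    by (intro closed_Int closed_Collect_eq closed_Collect_le continuous_on_T cont_d continuous_intros)
  have "norm (u - q) \<le> \<bar>K\<bar> * sqrt (4 * d q)" if "u \<in> S" for u
  proof -
    \<comment> \<open>Parallelogram law for \<open>w 0 - u\<close> and
      \<open>w 0 - q\<close>.\<close>
    have "sip (u - q) (u - q) + sip ((w 0 - u) + (w 0 - q)) ((w 0 - u) + (w 0 - q)) = 2 * d u + 2 * d q"
      by (simp add: d_def sip_simps sip_commute algebra_simps)
    moreover have "0 \<le> sip ((w 0 - u) + (w 0 - q)) ((w 0 - u) + (w 0 - q))" by simp
    ultimately have "sip (u - q) (u - q) \<le> 4 * d q"
      using that unfolding S_def mem_Collect_eq Int_iff by linarith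
    then have "snorm (u - q) \<le> sqrt (4 * d q)"
      unfolding seminorm_of_def sip_def by simp
    moreover have "norm (u - q) \<le> K * snorm (u - q)"
      using lip[of u q] that q by (simp add: S_def)
    ultimately show ?thesis
      using K_ge_zero_mult[of "u - q"] mult_left_mono[of "snorm (u - q)" "sqrt (4 * d q)" "\<bar>K\<bar>"]
      by (metis abs_ge_zero order_trans)
  qed
  then have "S \<subseteq> cball q (\<bar>K\<bar> * sqrt (4 * d q))"
    by (auto simp: dist_norm norm_minus_commute)
  then have "compact S"
    using \<open>closed S\<close> bounded_cball bounded_subset compact_eq_bounded_closed by blast
  moreover have "S \<noteq> {}" using q by (auto simp: S_def)
  ultimately obtain p where p: "p \<in> S" "\<And>u. u \<in> S \<Longrightarrow> d p \<le> d u"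
    using continuous_attains_inf[of S d] cont_d continuous_on_subset by blast
  have Tp: "T p = p" using p by (simp add: S_def)
  have min: "d p \<le> d u" if "T u = u" for u
    using p(2)[of u] p(2)[of q] q that by (cases "d u \<le> d q") (auto simp: S_def)
  have mins: "snorm (w 0 - p) \<le> snorm (w 0 - u)" if "T u = u" for u
    using min[OF that] by (simp add: seminorm_of_def d_def sip_def)
  have vi: "sip (w 0 - p) (u - p) \<le> 0" if u: "T u = u" for u
  proof -
    define s where "s = sip (w 0 - p) (u - p)"
    define n where "n = sip (u - p) (u - p)"
    \<comment> \<open>Convex combinations of fixed points are fixed only up to seminorm zero, which suffices
      since \<open>d\<close> sees only the seminorm.\<close>
    have ineq: "2 * s \<le> t * n" if t: "0 < t" "t < 1" for t
    proof -
      define v where "v = (1 - t) *\<^sub>R p + t *\<^sub>R u"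
      have vp: "v = p + t *\<^sub>R (u - p)" by (simp add: v_def algebra_simps)
      \<comment> \<open>Firmness at \<open>v\<close> against \<open>p\<close> and \<open>u\<close>,
        weighted so that the second arguments combine to \<open>T v - v\<close>.\<close>
      have "0 \<le> (1 - t) * sip (v - T v) (T v - p) + t * sip (v - T v) (T v - u)"
        using firm[of v p] firm[of v u] t Tp u
        by (intro add_nonneg_nonneg mult_nonneg_nonneg) (simp_all add: algebra_simps)
      also have "\<dots> = - sip (v - T v) (v - T v)"
        unfolding v_def by (simp add: sip_simps sip_commute algebra_simps)
      finally have z: "sip (v - T v) (v - T v) = 0"
        using sip_ge_zero[of "v - T v"] by linarith
      have "d (T v) = d v"
      proof -
        have *: "sip x (T v) = sip x v" for x
          by (simp add: sip_def fixed_of_snorm_zero(2)[OF z])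
        then have "sip (T v) x = sip v x" for x by (metis sip_commute)
        with * show ?thesis by (simp add: d_def sip_simps)
      qed
      then have "d p \<le> d v" using min fixed_of_snorm_zero(1)[OF z] by metis
      \<comment> \<open>First variation of \<open>d\<close> along the segment; dividing by
        \<open>t\<close> and letting it tend to 0 gives the variational inequality.\<close>
      also have "d v = d p - 2 * t * s + t * t * n"
        unfolding d_def vp s_def n_def by (simp add: sip_simps sip_commute algebra_simps)
      finally have "t * (2 * s) \<le> t * (t * n)" by simp
      with t show ?thesis by (simp add: mult_le_cancel_left)
    qed
    have "((\<lambda>t. t * n) \<longlongrightarrow> 0 * n) (at_right 0)" by (intro tendsto_intros)
    moreover have "\<forall>\<^sub>F t in at_right 0. 2 * s \<le> t * n"
      using eventually_at_right_real[of 0 "1::real"]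
      by (auto elim!: eventually_mono intro: ineq)
    ultimately have "2 * s \<le> 0 * n"
      using tendsto_lowerbound trivial_limit_at_right_real by blast
    then show ?thesis by (simp add: s_def)
  qed
  show ?thesis using that Tp mins vi by blast
qed

section \<open>Boundedness of the iterates\<close>

lemma relaxed_nonexpansive:
  assumes "T p = p"
  shows "sip (u - res u - p) (u - res u - p) \<le> sip (u - p) (u - p)"
  using res_cocoercive[of u p]
  by (simp add: res_fixed[OF assms] sip_simps sip_commute algebra_simps)

lemma step_diff:
  "w (Suc k) - p = (1 / (real k + 2)) *\<^sub>R (w 0 - p)
     + ((real k + 1) / (real k + 2)) *\<^sub>R (w k - res (w k) - p)"
proof -
  have "(1 / (real k + 2)) *\<^sub>R p + ((real k + 1) / (real k + 2)) *\<^sub>R p = p"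
    by (simp add: scaleR_add_left[symmetric] field_simps)
  then show ?thesis unfolding step_res by (simp add: algebra_simps)
qed

lemma step_scaled:
  "(real k + 2) *\<^sub>R (w (Suc k) - p) = (w 0 - p) + (real k + 1) *\<^sub>R (w k - res (w k) - p)"
proof -
  have "real k + 2 \<noteq> 0" by linarith
  then show ?thesis unfolding step_diff by (simp add: scaleR_add_right)
qed

text \<open>Halpern's recursion: the step reads
  \<open>c *\<^sub>R y - a = (c - 1) *\<^sub>R x\<close>, and squared seminorms are compared. The
  weights \<open>k + 2\<close> and \<open>k + 1\<close> are kept so that it telescopes.\<close>

lemma step_seminorm:
  assumes "T p = p"
  shows "(real k + 2) * sip (w (Suc k) - p) (w (Suc k) - p)
    \<le> (real k + 1) * sip (w k - p) (w k - p) + 2 * sip (w 0 - p) (w (Suc k) - p)"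
proof -
  define c :: real where "c = real k + 2"
  define a where "a = w 0 - p"
  define x where "x = w k - res (w k) - p"
  define y where "y = w (Suc k) - p"
  have c: "1 < c" "real k + 1 = c - 1" "real k + 2 = c" by (simp_all add: c_def)
  have y: "c *\<^sub>R y = a + (c - 1) *\<^sub>R x"
    using step_scaled[of k p] by (simp add: a_def x_def y_def c_def)
  have x: "sip x x \<le> sip (w k - p) (w k - p)"
    unfolding x_def by (rule relaxed_nonexpansive[OF assms])
  have "c * (c * sip y y) - 2 * (c * sip a y) = (c - 1) * ((c - 1) * sip x x) - sip a a"
  proof -
    have 1: "c * (c * sip y y) = sip (c *\<^sub>R y) (c *\<^sub>R y)" "c * sip a y = sip a (c *\<^sub>R y)"
      by (simp_all add: sip_simps)
    show ?thesis unfolding 1 y by (simp add: sip_simps sip_commute algebra_simps)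
  qed
  also have "\<dots> \<le> (c - 1) * ((c - 1) * sip x x)" by simp
  also have "\<dots> \<le> (c - 1) * (c * sip x x)"
    by (intro mult_left_mono mult_right_mono) (use c in auto)
  also have "\<dots> \<le> (c - 1) * (c * sip (w k - p) (w k - p))"
    by (intro mult_left_mono x) (use c in auto)
  finally have "c * (c * sip y y) \<le> c * ((c - 1) * sip (w k - p) (w k - p) + 2 * sip a y)"
    by (simp add: algebra_simps)
  then show ?thesis
    using c unfolding c y_def[symmetric] a_def[symmetric] by (simp add: mult_le_cancel_left)
qed

text \<open>Each step averages the anchor with a relaxed point no farther from \<open>p\<close> than
  \<open>w k\<close>.\<close>

lemma seminorm_bounded:
  assumes "T p = p"
  shows "sip (w k - p) (w k - p) \<le> sip (w 0 - p) (w 0 - p)"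
proof (induction k)
  case 0
  show ?case by simp
next
  case (Suc k)
  define c where "c = real k + 2"
  define a where "a = w 0 - p"
  define x where "x = w k - res (w k) - p"
  define y where "y = w (Suc k) - p"
  have c: "1 < c" by (simp add: c_def)
  have y: "c *\<^sub>R y = a + (c - 1) *\<^sub>R x"
    using step_scaled[of k p] by (simp add: a_def x_def y_def c_def)
  have "sip x x \<le> sip (w k - p) (w k - p)"
    unfolding x_def by (rule relaxed_nonexpansive[OF assms])
  with Suc have x: "sip x x \<le> sip a a" by (simp add: a_def)
  have "c * (c * sip y y) = sip (a + (c - 1) *\<^sub>R x) (a + (c - 1) *\<^sub>R x)"
    unfolding y[symmetric] by (simp add: sip_simps)
  also have "\<dots> = sip a a + (c - 1) * (2 * sip a x) + (c - 1) * ((c - 1) * sip x x)"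
    by (simp add: sip_simps sip_commute[of x a] algebra_simps)
  also have "\<dots> \<le> sip a a + (c - 1) * (2 * sip a a) + (c - 1) * ((c - 1) * sip a a)"
    using two_sip_le[of a x] x c by (intro add_mono mult_left_mono) auto
  also have "\<dots> = c * (c * sip a a)" by (simp add: algebra_simps)
  finally have "sip y y \<le> sip a a" using c by (simp add: mult_le_cancel_left)
  then show ?case by (simp add: a_def y_def)
qed

text \<open>The seminorm does not see the kernel of \<open>M\<close>. In norm, \<open>w k\<close>
  enters with factor \<open>\<bar>\<gamma>\<bar> < 1\<close> only, and \<open>T (w k)\<close> is
  controlled through \<open>lip\<close>.\<close>

lemma norm_step_le:
  "norm (w (Suc k) - p) \<le> norm (w 0 - p) / (real k + 2)
    + (1 + \<gamma>) * norm (T (w k) - p) + \<bar>\<gamma>\<bar> * norm (w k - p)"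
proof -
  define x where "x = w k - res (w k) - p"
  have "x = (1 + \<gamma>) *\<^sub>R (T (w k) - p) - \<gamma> *\<^sub>R (w k - p)"
    by (simp add: x_def res_def algebra_simps)
  then have "norm x \<le> (1 + \<gamma>) * norm (T (w k) - p) + \<bar>\<gamma>\<bar> * norm (w k - p)"
    using norm_triangle_ineq4[of "(1 + \<gamma>) *\<^sub>R (T (w k) - p)" "\<gamma> *\<^sub>R (w k - p)"] \<gamma> by simp
  moreover have "((real k + 1) / (real k + 2)) * norm x \<le> 1 * norm x"
    by (intro mult_right_mono) auto
  moreover have "norm (w (Suc k) - p) \<le> norm (w 0 - p) / (real k + 2) + ((real k + 1) / (real k + 2)) * norm x"
    unfolding step_diff x_def[symmetric] by (rule norm_triangle_le) simp
  ultimately show ?thesis by linarith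
qed

lemma bounded_w: "bounded (range w)"
proof -
  obtain p where p: "T p = p" using fix_nonempty by blast
  have T: "norm (T (w k) - p) \<le> \<bar>K\<bar> * snorm (w 0 - p)" for k
  proof -
    have "norm (T (w k) - p) \<le> \<bar>K\<bar> * snorm (w k - p)"
      using lip[of "w k" p] K_ge_zero_mult[of "w k - p"] p by simp
    also have "\<dots> \<le> \<bar>K\<bar> * snorm (w 0 - p)"
      using seminorm_bounded[OF p, of k]
      by (intro mult_left_mono) (auto simp: seminorm_of_def sip_def)
    finally show ?thesis .
  qed
  define c where "c = norm (w 0 - p) + (1 + \<gamma>) * (\<bar>K\<bar> * snorm (w 0 - p))"
  have "norm (w (Suc k) - p) \<le> c + \<bar>\<gamma>\<bar> * norm (w k - p)" for k
  proof -
    have "norm (w 0 - p) / (real k + 2) \<le> norm (w 0 - p)"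
      by (simp add: field_simps mult_left_mono)
    moreover have "(1 + \<gamma>) * norm (T (w k) - p) \<le> (1 + \<gamma>) * (\<bar>K\<bar> * snorm (w 0 - p))"
      by (intro mult_left_mono T) (use \<gamma> in auto)
    ultimately show ?thesis using norm_step_le[of k p] unfolding c_def by linarith
  qed
  then have "norm (w k - p) \<le> max (norm (w 0 - p)) (c / (1 - \<bar>\<gamma>\<bar>))" for k
    using bounded_contraction[of "\<bar>\<gamma>\<bar>" "\<lambda>k. norm (w k - p)" c k] \<gamma> by simp
  then show ?thesis
    unfolding bounded_def by (metis dist_norm norm_minus_commute rangeE)
qed

section \<open>Strong convergence\<close>

lemma residual_tendsto_zero: "(\<lambda>k. snorm (w k - T (w k))) \<longlonglongrightarrow> 0"
proof -
  obtain p where p: "T p = p" using fix_nonempty by blast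
  define c where "c = 2 * snorm (w 0 - p) / (1 + \<gamma>)"
  have "snorm (w k - T (w k)) \<le> c * inverse (real (Suc k))" for k
  proof -
    have "(1 + \<gamma>) * snorm (w k - T (w k)) * real (Suc k) \<le> 2 * snorm (w 0 - p)"
      using residual_rate[OF p, of k] by (simp add: algebra_simps)
    then have "(1 + \<gamma>) * snorm (w k - T (w k)) \<le> 2 * snorm (w 0 - p) / real (Suc k)"
      by (simp add: pos_le_divide_eq del: of_nat_Suc)
    then have "snorm (w k - T (w k)) \<le> 2 * snorm (w 0 - p) / real (Suc k) / (1 + \<gamma>)"
      using \<gamma> by (simp add: pos_le_divide_eq mult_ac del: of_nat_Suc)
    then show ?thesis by (simp add: c_def divide_inverse mult_ac del: of_nat_Suc)
  qed
  moreover have "(\<lambda>k. c * inverse (real (Suc k))) \<longlonglongrightarrow> 0"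
    using tendsto_mult_right_zero[OF LIMSEQ_inverse_real_of_nat] by simp
  ultimately show ?thesis
    using tendsto_sandwich[of "\<lambda>_. 0" _ sequentially "\<lambda>k. c * inverse (real (Suc k))" 0]
      seminorm_of_ge_zero by (auto simp: eventually_sequentially)
qed

text \<open>The limsup step of Halpern's argument: a violating subsequence has a cluster point
  \<open>v\<close> whose residual has seminorm zero, and then the fixed point \<open>T v\<close>
  contradicts \<open>vi\<close>.\<close>

lemma eventually_sip_le:
  assumes vi: "\<And>u. T u = u \<Longrightarrow> sip a (u - p) \<le> 0" and "0 < \<epsilon>"
  shows "\<forall>\<^sub>F k in sequentially. sip a (w k - p) \<le> \<epsilon>"
proof (rule ccontr)
  assume "\<not> ?thesis"
  then have "\<exists>\<^sub>F k in sequentially. \<epsilon> < sip a (w k - p)"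
    by (simp add: frequently_def not_less)
  then have "infinite {k. \<epsilon> < sip a (w k - p)}"
    by (simp add: frequently_cofinite cofinite_eq_sequentially[symmetric])
  then obtain \<phi> :: "nat \<Rightarrow> nat" where \<phi>: "strict_mono \<phi>" "\<And>j. \<epsilon> < sip a (w (\<phi> j) - p)"
    using infinite_enumerate by blast
  have "bounded (range (\<lambda>j. w (\<phi> j)))"
    by (rule bounded_subset[OF bounded_w]) auto
  then obtain v \<psi> where \<psi>: "strict_mono \<psi>" "((\<lambda>j. w (\<phi> j)) \<circ> \<psi>) \<longlonglongrightarrow> v"
    using bounded_imp_convergent_subsequence by metis
  define \<theta> where "\<theta> = \<phi> \<circ> \<psi>"
  have \<theta>: "strict_mono \<theta>" unfolding \<theta>_def using \<phi> \<psi> strict_mono_o by blast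
  have lim: "(\<lambda>j. w (\<theta> j)) \<longlonglongrightarrow> v" using \<psi>(2) by (simp add: \<theta>_def o_def)
  have limT: "(\<lambda>j. T (w (\<theta> j))) \<longlonglongrightarrow> T v"
    using continuous_on_tendsto_compose[OF continuous_on_T lim] by simp
  have "(\<lambda>j. (snorm (w (\<theta> j) - T (w (\<theta> j))))\<^sup>2) \<longlonglongrightarrow> 0\<^sup>2"
    using LIMSEQ_subseq_LIMSEQ[OF residual_tendsto_zero \<theta>] by (intro tendsto_intros) (simp add: o_def)
  moreover have "(\<lambda>j. sip (w (\<theta> j) - T (w (\<theta> j))) (w (\<theta> j) - T (w (\<theta> j))))
      \<longlonglongrightarrow> sip (v - T v) (v - T v)"
    by (intro tendsto_intros lim limT)
  ultimately have z: "sip (v - T v) (v - T v) = 0"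
    unfolding seminorm_of_power2 using LIMSEQ_unique by fastforce
  have "(\<lambda>j. sip a (w (\<theta> j) - p)) \<longlonglongrightarrow> sip a (v - p)"
    by (intro tendsto_intros lim)
  then have "\<epsilon> \<le> sip a (v - p)"
    by (rule LIMSEQ_le_const) (use \<phi> in \<open>auto simp: \<theta>_def intro: less_imp_le\<close>)
  also have "\<dots> = sip a (T v - p)"
    using fixed_of_snorm_zero(2)[OF z] by (simp add: sip_def linear_diff[OF linear_M])
  also have "\<dots> \<le> 0" using vi fixed_of_snorm_zero(1)[OF z] by blast
  finally show False using \<open>0 < \<epsilon>\<close> by simp
qed

lemma seminorm_tendsto_zero:
  assumes p: "T p = p" and vi: "\<And>u. T u = u \<Longrightarrow> sip (w 0 - p) (u - p) \<le> 0"
  shows "(\<lambda>k. snorm (w k - p)) \<longlonglongrightarrow> 0"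
proof -
  define a where "a k = sip (w k - p) (w k - p)" for k
  have "a \<longlonglongrightarrow> 0"
  proof (rule LIMSEQ_I)
    fix r :: real
    assume "0 < r"
    define \<epsilon> where "\<epsilon> = r / 4"
    have "0 < \<epsilon>" using \<open>0 < r\<close> by (simp add: \<epsilon>_def)
    obtain N where N: "\<And>k. N \<le> k \<Longrightarrow> sip (w 0 - p) (w k - p) \<le> \<epsilon>"
      using eventually_sip_le[OF vi \<open>0 < \<epsilon>\<close>] by (auto simp: eventually_sequentially)
    \<comment> \<open>The recursion adds at most \<open>2 * \<epsilon>\<close> per step from
      \<open>N\<close> on; subtracting \<open>2 * \<epsilon>\<close> before weighting makes
      \<open>b\<close> nonincreasing there.\<close>
    define b where "b k = (real k + 1) * (a k - 2 * \<epsilon>)" for k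
    have b_Suc: "b (Suc k) \<le> b k" if "N \<le> k" for k
      using step_seminorm[OF p, of k] N[of "Suc k"] that
      by (simp add: b_def a_def algebra_simps)
    have b: "b k \<le> b N" if "N \<le> k" for k
      using that
    proof (induction k rule: dec_induct)
      case (step k)
      then show ?case using b_Suc[of k] by simp
    qed simp
    have "(\<lambda>k. \<bar>b N\<bar> * inverse (real (Suc k))) \<longlonglongrightarrow> 0"
      using tendsto_mult_right_zero[OF LIMSEQ_inverse_real_of_nat] by simp
    then obtain J where J: "\<And>k. J \<le> k \<Longrightarrow> \<bar>b N\<bar> * inverse (real (Suc k)) < \<epsilon>"
      using LIMSEQ_D[of "\<lambda>k. \<bar>b N\<bar> * inverse (real (Suc k))" 0 \<epsilon>] \<open>0 < \<epsilon>\<close> by force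
    have "norm (a k - 0) < r" if k: "max N J \<le> k" for k
    proof -
      have "(real k + 1) * (a k - 2 * \<epsilon>) \<le> \<bar>b N\<bar>"
        using b[of k] k by (simp add: b_def)
      then have "a k - 2 * \<epsilon> \<le> \<bar>b N\<bar> * inverse (real (Suc k))"
        by (simp add: field_simps)
      also have "\<dots> < \<epsilon>" using J k by simp
      finally have "a k < r" using \<open>0 < r\<close> by (simp add: \<epsilon>_def)
      moreover have "0 \<le> a k" by (simp add: a_def)
      ultimately show ?thesis by simp
    qed
    then show "\<exists>no. \<forall>k\<ge>no. norm (a k - 0) < r" by blast
  qed
  then have "(\<lambda>k. sqrt (a k)) \<longlonglongrightarrow> sqrt 0" by (intro tendsto_intros)
  then show ?thesis by (simp add: a_def seminorm_of_def sip_def)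
qed

text \<open>\<open>T (w k)\<close> converges first, through \<open>lip\<close>, and \<open>w\<close>
  follows by contraction. Minimality of \<open>p\<close> is recorded to identify the seminorm
  distance in the rate.\<close>

lemma halpern_convergence:
  obtains p where "T p = p" "w \<longlonglongrightarrow> p" "(\<lambda>k. T (w k)) \<longlonglongrightarrow> p"
    "\<And>u. T u = u \<Longrightarrow> snorm (w 0 - p) \<le> snorm (w 0 - u)"
proof -
  obtain p where p: "T p = p" "\<And>u. T u = u \<Longrightarrow> snorm (w 0 - p) \<le> snorm (w 0 - u)"
    "\<And>u. T u = u \<Longrightarrow> sip (w 0 - p) (u - p) \<le> 0"
    using projection_exists by metis
  have "(\<lambda>k. K * snorm (w k - p)) \<longlonglongrightarrow> 0"
    using seminorm_tendsto_zero[OF p(1,3)] by (rule tendsto_mult_right_zero)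
  moreover have "\<forall>\<^sub>F k in sequentially. norm (T (w k) - p) \<le> K * snorm (w k - p)"
    using lip[of _ p] p(1) by simp
  ultimately have T0: "(\<lambda>k. T (w k) - p) \<longlonglongrightarrow> 0"
    by (rule Lim_null_comparison[rotated])
  define d where "d k = norm (w 0 - p) * inverse (real k + 2) + (1 + \<gamma>) * norm (T (w k) - p)" for k
  have "(\<lambda>k. inverse (real k + 2)) \<longlonglongrightarrow> 0"
    using LIMSEQ_ignore_initial_segment[OF lim_inverse_n, of 2] by (simp add: add.commute)
  then have "d \<longlonglongrightarrow> norm (w 0 - p) * 0 + (1 + \<gamma>) * 0"
    unfolding d_def using tendsto_norm_zero[OF T0] by (intro tendsto_intros)
  then have "d \<longlonglongrightarrow> 0" by simp
  moreover have "norm (w (Suc k) - p) \<le> d k + \<bar>\<gamma>\<bar> * norm (w k - p)" for k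
    using norm_step_le[of k p] by (simp add: d_def divide_inverse)
  ultimately have "(\<lambda>k. norm (w k - p)) \<longlonglongrightarrow> 0"
    using tendsto_zero_contraction[of "\<bar>\<gamma>\<bar>" "\<lambda>k. norm (w k - p)" d] \<gamma> by simp
  then have "w \<longlonglongrightarrow> p" using LIM_zero_iff tendsto_norm_zero_iff by blast
  moreover have "(\<lambda>k. T (w k)) \<longlonglongrightarrow> p" using T0 LIM_zero_iff by blast
  ultimately show ?thesis using that p by blast
qed

end

section \<open>Subdifferentials\<close>

lemma convex_epiD:
  assumes "convex (epi g)" "g x \<le> ereal a" "g z \<le> ereal b" "0 \<le> t" "t \<le> 1"
  shows "g ((1 - t) *\<^sub>R x + t *\<^sub>R z) \<le> ereal ((1 - t) * a + t * b)"
proof -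
  have "(1 - t) *\<^sub>R (x, a) + t *\<^sub>R (z, b) \<in> epi g"
    using assms by (intro convexD) (auto simp: epi_def)
  then show ?thesis by (simp add: epi_def)
qed

lemma GDERIV_directional_lim:
  fixes f :: "'a::real_inner \<Rightarrow> real"
  assumes "GDERIV f x :> D"
  shows "((\<lambda>t. (f (x + t *\<^sub>R v) - f x) / t) \<longlongrightarrow> D \<bullet> v) (at 0)"
proof -
  have "((\<lambda>t. x + t *\<^sub>R v) has_derivative (\<lambda>t. t *\<^sub>R v)) (at 0)"
    by (auto intro!: derivative_eq_intros)
  moreover have "(f has_derivative (\<lambda>h. h \<bullet> D)) (at (x + 0 *\<^sub>R v))"
    using assms by (simp add: gderiv_def)
  ultimately have "((\<lambda>t. f (x + t *\<^sub>R v)) has_derivative (\<lambda>t. (t *\<^sub>R v) \<bullet> D)) (at 0)"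
    by (rule has_derivative_compose)
  moreover have "(\<lambda>t. (t *\<^sub>R v) \<bullet> D) = (*) (D \<bullet> v)"
    by (auto simp: inner_commute)
  ultimately have "((\<lambda>t. f (x + t *\<^sub>R v)) has_field_derivative (D \<bullet> v)) (at 0)"
    by (simp add: has_field_derivative_def)
  then show ?thesis by (simp add: DERIV_def)
qed

text \<open>Convexity bounds each difference quotient on the segment by
  \<open>f z - f x\<close>.\<close>

lemma convex_on_GDERIV_above_tangent:
  fixes f :: "'a::real_inner \<Rightarrow> real"
  assumes "convex_on UNIV f" "GDERIV f x :> D"
  shows "f x + D \<bullet> (z - x) \<le> f z"
proof -
  have "((\<lambda>t. (f (x + t *\<^sub>R (z - x)) - f x) / t) \<longlongrightarrow> D \<bullet> (z - x)) (at_right 0)"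
    using GDERIV_directional_lim[OF assms(2)] by (rule tendsto_within_subset) simp
  moreover have "\<forall>\<^sub>F t in at_right 0. (f (x + t *\<^sub>R (z - x)) - f x) / t \<le> f z - f x"
    using eventually_at_right_real[of 0 "1::real"]
  proof (rule eventually_mono)
    show "0 < (1::real)" by simp
    fix t :: real
    assume t: "t \<in> {0<..<1}"
    have "f ((1 - t) *\<^sub>R x + t *\<^sub>R z) \<le> (1 - t) * f x + t * f z"
      using t by (intro convex_onD[OF assms(1)]) auto
    moreover have "(1 - t) *\<^sub>R x + t *\<^sub>R z = x + t *\<^sub>R (z - x)" by (simp add: algebra_simps)
    ultimately show "(f (x + t *\<^sub>R (z - x)) - f x) / t \<le> f z - f x"
      using t by (simp add: field_simps)
  qed
  ultimately have "D \<bullet> (z - x) \<le> f z - f x"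
    using tendsto_upperbound trivial_limit_at_right_real by blast
  then show ?thesis by simp
qed

text \<open>Sum rule with equality. Given a subgradient of the sum, its inequality is used at
  \<open>x + t *\<^sub>R (z - x)\<close>, where \<open>g\<close> lies below its chord; dividing by
  \<open>t\<close> and letting it tend to 0 leaves only the derivative of \<open>f\<close>. The
  converse adds the tangent inequality.\<close>

lemma subdiff_objective:
  assumes "convex_on UNIV f" "GDERIV f x :> D" "\<And>x. g x \<noteq> -\<infinity>" "convex (epi g)"
  shows "subdiff (objective f g) x = (\<lambda>u. D + u) ` subdiff g x"
proof (intro equalityI subsetI)
  fix v
  assume "v \<in> subdiff (objective f g) x"
  then have fin: "\<bar>objective f g x\<bar> \<noteq> \<infinity>"
    and v: "\<And>z. objective f g x + ereal (v \<bullet> (z - x)) \<le> objective f g z"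
    by (auto simp: subdiff_def)
  obtain a where a: "g x = ereal a"
    using fin by (cases "g x") (auto simp: objective_def)
  have "g x + ereal ((v - D) \<bullet> (z - x)) \<le> g z" for z
  proof (cases "g z")
    case (real b)
    have "((\<lambda>t. (f (x + t *\<^sub>R (z - x)) - f x) / t + (b - a)) \<longlongrightarrow> D \<bullet> (z - x) + (b - a)) (at_right 0)"
      by (intro tendsto_intros tendsto_within_subset[OF GDERIV_directional_lim[OF assms(2)]]) simp
    moreover have "\<forall>\<^sub>F t in at_right 0. v \<bullet> (z - x) \<le> (f (x + t *\<^sub>R (z - x)) - f x) / t + (b - a)"
      using eventually_at_right_real[of 0 "1::real"]
    proof (rule eventually_mono)
      show "0 < (1::real)" by simp
      fix t :: real
      assume t: "t \<in> {0<..<1}"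
      define y where "y = x + t *\<^sub>R (z - x)"
      have y: "y = (1 - t) *\<^sub>R x + t *\<^sub>R z" by (simp add: y_def algebra_simps)
      have "g y \<le> ereal ((1 - t) * a + t * b)"
        unfolding y using t a real by (intro convex_epiD assms) auto
      from add_left_mono[OF this, of "ereal (f y)"]
      have "objective f g y \<le> ereal (f y + ((1 - t) * a + t * b))"
        by (simp add: objective_def)
      with v[of y] have "objective f g x + ereal (v \<bullet> (y - x)) \<le> ereal (f y + ((1 - t) * a + t * b))"
        by (rule order_trans)
      then have "f x + a + t * (v \<bullet> (z - x)) \<le> f y + ((1 - t) * a + t * b)"
        by (simp add: objective_def a y_def)
      then have "t * (v \<bullet> (z - x)) \<le> (f y - f x) + t * (b - a)" by (simp add: algebra_simps)
      then have "v \<bullet> (z - x) \<le> ((f y - f x) + t * (b - a)) / t"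
        using t by (simp add: pos_le_divide_eq mult.commute)
      then show "v \<bullet> (z - x) \<le> (f (x + t *\<^sub>R (z - x)) - f x) / t + (b - a)"
        using t by (simp add: y_def add_divide_distrib)
    qed
    ultimately have "v \<bullet> (z - x) \<le> D \<bullet> (z - x) + (b - a)"
      using tendsto_lowerbound trivial_limit_at_right_real by blast
    then show ?thesis by (simp add: a real inner_diff_left)
  qed (use assms(3) in auto)
  then have "v - D \<in> subdiff g x" by (simp add: subdiff_def a)
  then show "v \<in> (\<lambda>u. D + u) ` subdiff g x"
    by (metis add.commute diff_add_cancel image_eqI)
next
  fix v
  assume "v \<in> (\<lambda>u. D + u) ` subdiff g x"
  then obtain u where v: "v = D + u" and fin: "\<bar>g x\<bar> \<noteq> \<infinity>"
    and u: "\<And>z. g x + ereal (u \<bullet> (z - x)) \<le> g z"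
    by (auto simp: subdiff_def)
  obtain a where a: "g x = ereal a" using fin by (cases "g x") auto
  have "objective f g x + ereal (v \<bullet> (z - x)) \<le> objective f g z" for z
    using u[of z] convex_on_GDERIV_above_tangent[OF assms(1,2), of z]
    by (cases "g z") (auto simp: objective_def a v inner_add_left)
  then show "v \<in> subdiff (objective f g) x" by (simp add: subdiff_def objective_def a)
qed

lemma subdiff_finite:
  assumes "u \<in> subdiff \<Phi> x"
  obtains a where "\<Phi> x = ereal a"
  using assms by (cases "\<Phi> x") (auto simp: subdiff_def)

lemma subdiffD:
  assumes "u \<in> subdiff \<Phi> x" "\<Phi> x = ereal a" "\<Phi> z = ereal c"
  shows "a + u \<bullet> (z - x) \<le> c"
proof -
  have "\<Phi> x + ereal (u \<bullet> (z - x)) \<le> \<Phi> z" using assms(1) by (simp add: subdiff_def)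
  then show ?thesis by (simp add: assms(2,3))
qed

lemma subdiff_monotone:
  assumes "u \<in> subdiff \<Phi> x" "v \<in> subdiff \<Phi> z"
  shows "0 \<le> (u - v) \<bullet> (x - z)"
proof -
  obtain a c where ac: "\<Phi> x = ereal a" "\<Phi> z = ereal c"
    using assms subdiff_finite by metis
  from subdiffD[OF assms(1) ac] subdiffD[OF assms(2) ac(2,1)] show ?thesis
    by (simp add: inner_diff_left inner_diff_right)
qed

section \<open>The primal-dual operators\<close>

lemma inner_transpose_matrix_vector:
  fixes A :: "real^'n^'m"
  shows "(transpose A *v y) \<bullet> x = y \<bullet> (A *v x)"
  by (metis dot_lmul_matrix transpose_matrix_vector)

text \<open>Keeps \<open>transpose A *v y\<close> in the form in which the block operators and the
  adjoint identity state it.\<close>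

declare transpose_matrix_vector [simp del]

text \<open>The coupling through \<open>A\<close> is skew and cancels; the subdifferential part and
  \<open>\<sigma>\<close> times a square remain.\<close>

lemma opT_monotone:
  assumes "0 \<le> \<sigma>" "s \<in> opT \<Phi> A b \<sigma> v" "s' \<in> opT \<Phi> A b \<sigma> v'"
  shows "0 \<le> (s - s') \<bullet> (v - v')"
proof -
  obtain x y x' y' where v: "v = (x, y)" "v' = (x', y')" by (metis surj_pair)
  obtain u where u: "u \<in> subdiff \<Phi> x"
    and s: "s = (u - transpose A *v y + \<sigma> *\<^sub>R (transpose A *v (A *v x - b)), A *v x - b)"
    using assms(2) by (auto simp: opT_def v)
  obtain u' where u': "u' \<in> subdiff \<Phi> x'"
    and s': "s' = (u' - transpose A *v y' + \<sigma> *\<^sub>R (transpose A *v (A *v x' - b)), A *v x' - b)"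
    using assms(3) by (auto simp: opT_def v)
  define d e where "d = x - x'" and "e = y - y'"
  have "s - s' = ((u - u') - transpose A *v e + \<sigma> *\<^sub>R (transpose A *v (A *v d)), A *v d)"
    by (simp add: s s' d_def e_def matrix_vector_mult_diff_distrib scaleR_diff_right)
  then have "(s - s') \<bullet> (v - v') = (u - u') \<bullet> d + \<sigma> * ((A *v d) \<bullet> (A *v d))"
    unfolding v by (simp add: d_def[symmetric] e_def[symmetric] inner_add_left inner_diff_left
        inner_transpose_matrix_vector inner_commute[of e "A *v d"])
  then show ?thesis
    using subdiff_monotone[OF u u'] assms(1) by (simp add: d_def)
qed

lemma pos_def_inverse:
  fixes Q :: "'a::euclidean_space \<Rightarrow> 'a"
  assumes "pos_def Q"
  obtains R where "linear R" "\<And>y z. Q y = z \<longleftrightarrow> y = R z"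
proof -
  have "linear Q" using assms by (simp add: pos_def_def selfadjoint_def)
  moreover have "y = 0" if "Q y = 0" for y
  proof (rule ccontr)
    assume "y \<noteq> 0"
    then have "0 < y \<bullet> Q y" using assms by (simp add: pos_def_def)
    with that show False by simp
  qed
  ultimately have "inj Q" by (auto simp: linear_injective_0)
  then obtain R where "linear R" "\<And>x. R (Q x) = x" "\<And>x. Q (R x) = x"
    using linear_injective_isomorphism[OF \<open>linear Q\<close>] by metis
  then show ?thesis using that by metis
qed

lemma linear_lipschitz:
  fixes R :: "'a::euclidean_space \<Rightarrow> 'b::real_normed_vector"
  assumes "linear R"
  obtains B where "0 \<le> B" "\<And>x y. norm (R x - R y) \<le> B * norm (x - y)"
proof -
  obtain B where "0 < B" "\<And>x. norm (R x) \<le> B * norm x"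
    using linear_bounded_pos[OF assms] by blast
  then show ?thesis
    using that[of B] linear_diff[OF assms] by (metis less_imp_le)
qed

text \<open>Block elimination: the dual terms of \<open>opM\<close> and \<open>opT\<close> cancel in
  the first row, which becomes an inclusion for \<open>opG\<close> in \<open>x\<close> alone; the
  second row then determines \<open>y\<close> through \<open>Q\<close>.\<close>

lemma resolvent_eq_iff:
  fixes A :: "real^'n^'m"
  assumes h: "\<And>z. sv_inverse (opG \<Phi> P A \<sigma>) z = {h z}" and R: "\<And>y z. Q *v y = z \<longleftrightarrow> y = R z"
  shows "(r, s) \<in> {opM P Q A v + t | t. t \<in> opT \<Phi> A b \<sigma> v} \<longleftrightarrow>
    v = (h (r + \<sigma> *\<^sub>R (transpose A *v b)),
         R (s + b - 2 *\<^sub>R (A *v h (r + \<sigma> *\<^sub>R (transpose A *v b)))))"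
proof -
  obtain x y where v: "v = (x, y)" by (cases v)
  let ?z = "r + \<sigma> *\<^sub>R (transpose A *v b)"
  have "(r, s) \<in> {opM P Q A v + t | t. t \<in> opT \<Phi> A b \<sigma> v} \<longleftrightarrow>
     (\<exists>u \<in> subdiff \<Phi> x. r = P *v x + u + \<sigma> *\<^sub>R (transpose A *v (A *v x - b)))
      \<and> s = A *v x + Q *v y + (A *v x - b)"
  proof -
    have *: "P *v x + a + (u - a + c) = P *v x + u + c" for a u c by simp
    have "(r, s) \<in> {opM P Q A v + t | t. t \<in> opT \<Phi> A b \<sigma> v} \<longleftrightarrow>
      (\<exists>u \<in> subdiff \<Phi> x. (r, s) = opM P Q A (x, y)
        + (u - transpose A *v y + \<sigma> *\<^sub>R (transpose A *v (A *v x - b)), A *v x - b))"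
      unfolding v by (auto simp: opT_def)
    then show ?thesis by (simp add: opM_def *)
  qed
  also have "(\<exists>u \<in> subdiff \<Phi> x. r = P *v x + u + \<sigma> *\<^sub>R (transpose A *v (A *v x - b)))
      \<longleftrightarrow> ?z \<in> opG \<Phi> P A \<sigma> x"
    by (auto simp: opG_def matrix_vector_mult_diff_distrib algebra_simps)
  also have "\<dots> \<longleftrightarrow> x = h ?z"
    using h[of ?z] by (auto simp: sv_inverse_def)
  also have "s = A *v x + Q *v y + (A *v x - b) \<longleftrightarrow> Q *v y = s + b - 2 *\<^sub>R (A *v x)"
    by (auto simp: algebra_simps scaleR_2)
  finally show ?thesis unfolding R v by auto
qed

text \<open>\<open>J\<close> is a function of \<open>z = M u\<close> rather than of
  \<open>u\<close>; combined with \<open>norm_M_le\<close> its Lipschitz bound yields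
  \<open>lip\<close>.\<close>

lemma resolvent_lipschitz:
  fixes A :: "real^'n^'m" and Q :: "real^'m^'m"
  assumes "has_lipschitz_inverse (opG \<Phi> P A \<sigma>)" "pos_def ((*v) Q)"
  obtains J K where "\<And>z v. z \<in> {opM P Q A v + t | t. t \<in> opT \<Phi> A b \<sigma> v} \<longleftrightarrow> v = J z"
    "0 \<le> K" "\<And>z z'. norm (J z - J z') \<le> K * norm (z - z')"
proof -
  obtain h L where h: "\<And>z. sv_inverse (opG \<Phi> P A \<sigma>) z = {h z}" and L: "L-lipschitz_on UNIV h"
    using assms(1) by (auto simp: has_lipschitz_inverse_def)
  obtain R where "linear R" and R: "\<And>y z. Q *v y = z \<longleftrightarrow> y = R z"
    using pos_def_inverse[OF assms(2)] by metis
  obtain B where B: "0 \<le> B" "\<And>x y. norm (R x - R y) \<le> B * norm (x - y)"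
    using linear_lipschitz[OF \<open>linear R\<close>] by metis
  obtain C where C: "0 \<le> C" "\<And>x y. norm (A *v x - A *v y) \<le> C * norm (x - y)"
    using linear_lipschitz[OF matrix_vector_mul_linear[of A]] by metis
  have "0 \<le> L" using lipschitz_on_nonneg[OF L] .
  define x where "x z = h (fst z + \<sigma> *\<^sub>R (transpose A *v b))" for z :: "(real^'n) \<times> (real^'m)"
  define J where "J z = (x z, R (snd z + b - 2 *\<^sub>R (A *v x z)))" for z :: "(real^'n) \<times> (real^'m)"
  have fst_le: "norm (fst z - fst z') \<le> norm (z - z')"
    and snd_le: "norm (snd z - snd z') \<le> norm (z - z')" for z z' :: "(real^'n) \<times> (real^'m)"
    by (metis fst_diff norm_fst_le prod.collapse) (metis snd_diff norm_snd_le prod.collapse)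
  have x: "norm (x z - x z') \<le> L * norm (z - z')" for z z'
  proof -
    have "norm (x z - x z') \<le> L * norm (fst z - fst z')"
      using lipschitz_onD[OF L, of "fst z + \<sigma> *\<^sub>R (transpose A *v b)" "fst z' + \<sigma> *\<^sub>R (transpose A *v b)"]
      by (simp add: x_def dist_norm)
    also have "\<dots> \<le> L * norm (z - z')"
      using \<open>0 \<le> L\<close> fst_le[of z z'] by (simp add: mult_left_mono)
    finally show ?thesis .
  qed
  \<comment> \<open>\<open>L\<close> bounds the primal component; \<open>C\<close> and
    \<open>B\<close> are the Lipschitz constants of \<open>A\<close> and of the inverse of
    \<open>Q\<close>.\<close>
  have "norm (J z - J z') \<le> (L + B * (1 + 2 * C * L)) * norm (z - z')" for z z'
  proof -
    have "norm ((snd z + b - 2 *\<^sub>R (A *v x z)) - (snd z' + b - 2 *\<^sub>R (A *v x z')))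
      = norm ((snd z - snd z') - 2 *\<^sub>R (A *v x z - A *v x z'))"
      by (simp add: algebra_simps)
    also have "\<dots> \<le> norm (snd z - snd z') + 2 * norm (A *v x z - A *v x z')"
      using norm_triangle_ineq4[of "snd z - snd z'" "2 *\<^sub>R (A *v x z - A *v x z')"] by simp
    also have "\<dots> \<le> norm (z - z') + 2 * (C * (L * norm (z - z')))"
      using C(2)[of "x z" "x z'"] mult_left_mono[OF x[of z z'] C(1)]
        snd_le[of z z'] by simp
    finally have "norm ((snd z + b - 2 *\<^sub>R (A *v x z)) - (snd z' + b - 2 *\<^sub>R (A *v x z')))
      \<le> norm (z - z') + 2 * (C * (L * norm (z - z')))" .
    with B have "norm (snd (J z) - snd (J z')) \<le> B * (norm (z - z') + 2 * (C * (L * norm (z - z'))))"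
      unfolding J_def snd_conv by (meson mult_left_mono order_trans)
    moreover have "norm (J z - J z') \<le> norm (x z - x z') + norm (snd (J z) - snd (J z'))"
      using norm_Pair_le[of "x z - x z'" "snd (J z) - snd (J z')"] by (simp add: J_def)
    ultimately show ?thesis using x[of z z'] by (simp add: algebra_simps)
  qed
  moreover have "0 \<le> L + B * (1 + 2 * C * L)"
    using \<open>0 \<le> L\<close> B(1) C(1) by simp
  moreover have "z \<in> {opM P Q A v + t | t. t \<in> opT \<Phi> A b \<sigma> v} \<longleftrightarrow> v = J z" for z v
    using resolvent_eq_iff[OF h R, where r = "fst z" and s = "snd z"] by (simp add: J_def x_def)
  ultimately show ?thesis using that by blast
qed

section \<open>KKT residual, zeros and objective values\<close>

lemma bounded_linear_opE: "bounded_linear (opE A \<sigma>)"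
proof -
  have "linear (opE A \<sigma>)"
    by (rule linearI) (auto simp: opE_def matrix_vector_right_distrib scaleR_right_diff_distrib
        matrix_vector_mult_scaleR algebra_simps)
  then show ?thesis using linear_conv_bounded_linear by blast
qed

lemma edist_set_eq_infdist: "S \<noteq> {} \<Longrightarrow> edist_set w S = ereal (infdist w S)"
proof -
  assume S: "S \<noteq> {}"
  then obtain a where "a \<in> S" by blast
  then have "(INF u\<in>S. ereal (dist w u)) \<le> ereal (dist w a)" by (rule INF_lower)
  moreover have "0 \<le> (INF u\<in>S. ereal (dist w u))" by (intro INF_greatest) simp
  ultimately have "\<bar>INF u\<in>S. ereal (dist w u)\<bar> \<noteq> \<infinity>" by auto
  then show ?thesis by (simp add: edist_set_def infdist_notempty[OF S] ereal_INF)
qed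

text \<open>\<open>opE\<close> subtracts \<open>\<sigma> *\<^sub>R transpose A\<close> applied to
  the second component, which is exactly the augmentation term of \<open>opT\<close>.\<close>

lemma opE_opT_in_opR:
  assumes "\<And>x. subdiff \<Phi> x = (\<lambda>u. df x + u) ` subdiff g x" "s \<in> opT \<Phi> A b \<sigma> v"
  shows "opE A \<sigma> s \<in> opR df g A b v"
proof -
  obtain x y where v: "v = (x, y)" by (cases v)
  show ?thesis
    using assms(2) unfolding v by (auto simp: opT_def opE_def opR_def assms(1))
qed

lemma zeros_opT:
  "(x, y) \<in> sv_inverse (opT \<Phi> A b \<sigma>) 0 \<longleftrightarrow> A *v x = b \<and> transpose A *v y \<in> subdiff \<Phi> x"
  by (auto simp: sv_inverse_def opT_def zero_prod_def)

lemma zeros_opT_eq_zeros_opR: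
  fixes A :: "real^'n^'m"
  assumes "\<And>x. subdiff \<Phi> x = (\<lambda>u. df x + u) ` subdiff g x"
  shows "sv_inverse (opT \<Phi> A b \<sigma>) 0 = sv_inverse (opR df g A b) 0"
proof (rule set_eqI)
  fix v :: "(real^'n) \<times> (real^'m)"
  obtain x y where v: "v = (x, y)" by (cases v)
  have "v \<in> sv_inverse (opR df g A b) 0 \<longleftrightarrow> A *v x = b \<and> transpose A *v y \<in> (\<lambda>u. df x + u) ` subdiff g x"
    unfolding v by (auto simp: sv_inverse_def opR_def zero_prod_def image_iff) metis
  then show "v \<in> sv_inverse (opT \<Phi> A b \<sigma>) 0 \<longleftrightarrow> v \<in> sv_inverse (opR df g A b) 0"
    unfolding v by (simp add: zeros_opT assms)
qed

text \<open>Two subgradient inequalities: at \<open>x\<close>, splitting \<open>u\<close> into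
  residual plus \<open>transpose A *v y\<close> bounds \<open>a - c\<close>; at \<open>xs\<close>,
  the multiplier \<open>ys\<close> paired with the constraint violation bounds
  \<open>c - a\<close>.\<close>

lemma objective_gap:
  fixes A :: "real^'n^'m"
  assumes u: "u \<in> subdiff \<Phi> x" "\<Phi> x = ereal a"
    and us: "transpose A *v ys \<in> subdiff \<Phi> xs" "\<Phi> xs = ereal c" "A *v xs = b"
  shows "\<bar>a - c\<bar> \<le> (norm (x - xs) + norm y + norm ys) * norm (u - transpose A *v y, A *v x - b)"
proof -
  define s t where "s = u - transpose A *v y" and "t = A *v x - b"
  define N where "N = norm (s, t)"
  have N: "norm s \<le> N" "norm t \<le> N" "0 \<le> N"
    unfolding N_def by (rule norm_fst_le, rule norm_snd_le) simp
  have t: "t = A *v (x - xs)" by (simp add: t_def us matrix_vector_mult_diff_distrib)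
  have "a - c \<le> u \<bullet> (x - xs)"
    using subdiffD[OF u us(2)] by (simp add: inner_diff_right)
  also have "\<dots> = s \<bullet> (x - xs) + y \<bullet> t"
    by (simp add: s_def t inner_diff_left inner_transpose_matrix_vector)
  also have "\<dots> \<le> norm s * norm (x - xs) + norm y * norm t"
    by (intro add_mono norm_cauchy_schwarz)
  also have "\<dots> \<le> N * norm (x - xs) + norm y * N"
    by (intro add_mono mult_left_mono mult_right_mono N) auto
  finally have upper: "a - c \<le> (norm (x - xs) + norm y) * N" by (simp add: algebra_simps)
  have "c - a \<le> - (ys \<bullet> t)"
    using subdiffD[OF us(1,2) u(2)] by (simp add: t inner_transpose_matrix_vector)
  also have "\<dots> \<le> norm ys * norm t"
    using norm_cauchy_schwarz[of "- ys" t] by simp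
  also have "\<dots> \<le> norm ys * N" by (intro mult_left_mono N) auto
  finally have lower: "c - a \<le> norm ys * N" .
  have "0 \<le> norm ys * N" "0 \<le> (norm (x - xs) + norm y) * N" using N by simp_all
  with upper lower show ?thesis
    unfolding N_def[symmetric] s_def[symmetric] t_def[symmetric] by (simp add: algebra_simps abs_le_iff)
qed

text \<open>Passes an estimate for every KKT residual vector to the distance; \<open>C = 0\<close>
  is separate because the proof divides by \<open>C\<close>.\<close>

lemma mult_infdist_ge:
  assumes "S \<noteq> {}" "0 \<le> C" "\<And>s. s \<in> S \<Longrightarrow> a \<le> C * dist w s"
  shows "a \<le> C * infdist w S"
proof (cases "C = 0")
  case True
  then show ?thesis using assms by auto
next
  case False
  then have "a / C \<le> dist w s" if "s \<in> S" for s
    using assms that by (simp add: pos_divide_le_eq mult.commute)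
  then have "a / C \<le> infdist w S"
    unfolding infdist_notempty[OF assms(1)] using assms(1) by (intro cINF_greatest)
  then show ?thesis using False assms(2) by (simp add: pos_divide_le_eq mult.commute)
qed

lemma bigo_inverse_nat:
  fixes a :: "nat \<Rightarrow> real"
  assumes "\<And>k. 0 \<le> a k" "\<And>k. a k \<le> c / (real k + 1)"
  shows "a \<in> O(\<lambda>k. 1 / real k)"
proof (rule bigoI)
  \<comment> \<open>\<open>1 / real 0\<close> is 0, so the bound is claimed for positive
    \<open>k\<close> only.\<close>
  have "norm (a k) \<le> c * norm (1 / real k)" if "0 < k" for k
  proof -
    have "0 \<le> c" using assms(1)[of 0] assms(2)[of 0] by simp
    then have "c / (real k + 1) \<le> c / real k"
      using that by (intro divide_left_mono) auto
    then show ?thesis using assms(1)[of k] assms(2)[of k] by simp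
  qed
  then show "\<forall>\<^sub>F k in sequentially. norm (a k) \<le> c * norm (1 / real k)"
    by (rule eventually_mono[OF eventually_gt_at_top[of "0::nat"]])
qed

theorem theorem1:
  fixes A :: "real^'n^'m" and b :: "real^'m" and \<sigma> :: real
    and f :: "real^'n \<Rightarrow> real" and df :: "real^'n \<Rightarrow> real^'n"
    and g :: "real^'n \<Rightarrow> ereal"
    and P :: "real^'n^'n" and Q :: "real^'m^'m"
    and \<gamma> :: real
    and w0 :: "(real^'n) \<times> (real^'m)"
    and w what wbar :: "nat \<Rightarrow> (real^'n) \<times> (real^'m)"
  assumes "\<sigma> \<ge> 0"
    and "convex_on UNIV f"
    and "\<And>x. GDERIV f x :> df x"
    and "continuous_on UNIV df"
    and "\<exists>L. L-lipschitz_on UNIV df"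
    and "proper_closed_convex g"
    and "{x. A *v x = b} \<noteq> {}"
    and "\<exists>x. A *v x = b \<and> (\<forall>z. A *v z = b \<longrightarrow> objective f g x \<le> objective f g z)"
    and "pos_semidef ((*v) P)"
    and "pos_semidef ((*v) Q)"
    and "pos_def ((*v) Q)"
    and "pos_semidef (opM P Q A)"
    and "has_lipschitz_inverse (opG (objective f g) P A \<sigma>)"
    and "sv_inverse (opT (objective f g) A b \<sigma>) 0 \<noteq> {}"
    and "-1 < \<gamma>" and "\<gamma> < 1"
    and "w 0 = w0"
    and "\<And>k. what k = resolvent_map (opM P Q A) (opT (objective f g) A b \<sigma>) (w k)"
    and "\<And>k. wbar k = (1 + \<gamma>) *\<^sub>R what k - \<gamma> *\<^sub>R w k"
    and "\<And>k. w (Suc k) = (1 / (real k + 2)) *\<^sub>R w0 + ((real k + 1) / (real k + 2)) *\<^sub>R wbar k"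
  shows "\<exists>xs ys.
      w \<longlonglongrightarrow> (xs, ys) \<and> what \<longlonglongrightarrow> (xs, ys)
    \<and> (xs, ys) \<in> sv_inverse (opT (objective f g) A b \<sigma>) 0
    \<and> sv_inverse (opT (objective f g) A b \<sigma>) 0 = sv_inverse (opR df g A b) 0
    \<and> (\<forall>k. r_KKT df g A b (what k) \<le>
           ereal (2 * onorm (opE A \<sigma>) * sqrt (onorm (opM P Q A)) / ((1 + \<gamma>) * (real k + 1)))
           * semidist_set (opM P Q A) w0 (sv_inverse (opT (objective f g) A b \<sigma>) 0))
    \<and> (\<lambda>k. real_of_ereal (r_KKT df g A b (what k))) \<in> O(\<lambda>k. 1 / real k)
    \<and> (let C = (SUP k. ereal (norm (fst (what k) - xs) + norm (snd (what k)))) + ereal (norm ys)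
       in C < \<infinity>
        \<and> (\<forall>k. \<bar>objective f g (fst (what k)) - objective f g xs\<bar> \<le> C * r_KKT df g A b (what k)))
    \<and> (\<lambda>k. real_of_ereal \<bar>objective f g (fst (what k)) - objective f g xs\<bar>) \<in> O(\<lambda>k. 1 / real k)"
proof -

  \<comment> \<open>The resolvent map as a Halpern iteration\<close>
  define \<Phi> where "\<Phi> = objective f g"
  define M where "M = opM P Q A"
  define S where "S = sv_inverse (opT \<Phi> A b \<sigma>) 0"
  define T where "T = resolvent_map M (opT \<Phi> A b \<sigma>)"
  note defs = \<Phi>_def[symmetric] M_def[symmetric]
  have sub: "subdiff \<Phi> x = (\<lambda>u. df x + u) ` subdiff g x" for x
    unfolding \<Phi>_def using assms(2,3,6)
    by (intro subdiff_objective) (auto simp: proper_closed_convex_def)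
  have SR: "S = sv_inverse (opR df g A b) 0"
    unfolding S_def by (rule zeros_opT_eq_zeros_opR[OF sub])
  have what: "what k = T (w k)" for k
    using assms(18) by (simp add: T_def defs)
  obtain J K where J: "\<And>z v. z \<in> {M v + t | t. t \<in> opT \<Phi> A b \<sigma> v} \<longleftrightarrow> v = J z"
    and K: "0 \<le> K" "\<And>z z'. norm (J z - J z') \<le> K * norm (z - z')"
    by (rule resolvent_lipschitz[OF assms(13)[unfolded defs] assms(11), where b = b, folded M_def]) (rule that)
  \<comment> \<open>Uniqueness of the solution \<open>J z\<close> lets the \<open>THE\<close> in
    \<open>resolvent_map\<close> be evaluated.\<close>
  have TJ: "T u = J (M u)" for u
    unfolding T_def resolvent_map_def sv_inverse_def mem_Collect_eq using J by simp
  \<comment> \<open>Both firmness of \<open>T\<close> and the KKT estimate start from this element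
    of the operator.\<close>
  have T_opT: "M u - M (T u) \<in> opT \<Phi> A b \<sigma> (T u)" for u
  proof -
    have "M u \<in> {M (T u) + t | t. t \<in> opT \<Phi> A b \<sigma> (T u)}" using J TJ by blast
    then show ?thesis by auto
  qed
  have fix_iff: "T u = u \<longleftrightarrow> u \<in> S" for u
  proof -
    have "T u = u \<longleftrightarrow> M u \<in> {M u + t | t. t \<in> opT \<Phi> A b \<sigma> u}"
      using J[of "M u" u] unfolding TJ by auto
    also have "\<dots> \<longleftrightarrow> 0 \<in> opT \<Phi> A b \<sigma> u"
      by (simp add: eq_commute[of "M u"] del: split_paired_Ex)
    finally show ?thesis by (simp add: S_def sv_inverse_def)
  qed
  have M: "pos_semidef_operator M"
    using assms(12) by (simp add: pos_semidef_operator_def M_def)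
  interpret pos_semidef_operator M by (rule M)
  interpret halpern_iteration M T "K * sqrt (onorm M)" \<gamma> w
  proof
    fix u v
    have "0 \<le> ((M u - M (T u)) - (M v - M (T v))) \<bullet> (T u - T v)"
      by (rule opT_monotone[OF assms(1) T_opT T_opT])
    also have "(M u - M (T u)) - (M v - M (T v)) = M ((u - v) - (T u - T v))"
      by (simp add: linear_diff[OF linear_M])
    finally have "0 \<le> sip (T u - T v) ((u - v) - (T u - T v))"
      unfolding sip_def by (subst inner_commute)
    then show "0 \<le> sip ((u - v) - (T u - T v)) (T u - T v)"
      by (subst sip_commute)
    have "norm (T u - T v) \<le> K * norm (M (u - v))"
      using K(2) by (simp add: TJ linear_diff[OF linear_M])
    also have "\<dots> \<le> K * (sqrt (onorm M) * seminorm_of M (u - v))"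
      by (intro mult_left_mono norm_M_le K)
    finally show "norm (T u - T v) \<le> K * sqrt (onorm M) * seminorm_of M (u - v)"
      by simp
  next
    show "{u. T u = u} \<noteq> {}"
      using assms(14) by (auto simp: fix_iff S_def \<Phi>_def)
  next
    fix k
    show "w (Suc k) = (1 / (real k + 2)) *\<^sub>R w 0
          + ((real k + 1) / (real k + 2)) *\<^sub>R ((1 + \<gamma>) *\<^sub>R T (w k) - \<gamma> *\<^sub>R w k)"
      unfolding assms(17,19,20) what ..
  qed (use assms in auto)
  obtain p where p: "T p = p" "w \<longlonglongrightarrow> p" "(\<lambda>k. T (w k)) \<longlonglongrightarrow> p"
    and p_min: "\<And>u. T u = u \<Longrightarrow> seminorm_of M (w 0 - p) \<le> seminorm_of M (w 0 - u)"
    using halpern_convergence by metis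
  obtain xs ys where xy: "p = (xs, ys)" by (cases p)
  have lim: "what \<longlonglongrightarrow> p" using p(3) by (simp add: what[symmetric])
  have pS: "p \<in> S" using p(1) fix_iff by simp

  \<comment> \<open>Rate of the KKT residual\<close>
  define D where "D = seminorm_of M (w0 - p)"
  \<comment> \<open>The infimum is attained at the projection \<open>p\<close>, so the rate against
    \<open>p\<close> is the rate in terms of the distance.\<close>
  have D: "semidist_set M w0 S = ereal D" unfolding semidist_set_def
  proof (rule antisym)
    show "(INF u\<in>S. ereal (seminorm_of M (w0 - u))) \<le> ereal D"
      unfolding D_def using pS by (rule INF_lower)
    show "ereal D \<le> (INF u\<in>S. ereal (seminorm_of M (w0 - u)))"
      using p_min assms(17) by (intro INF_greatest) (simp add: D_def fix_iff)
  qed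

  \<comment> \<open>An explicit element of the KKT operator, whose norm bounds the distance from
    0.\<close>
  define s where "s k = opE A \<sigma> (M (w k) - M (what k))" for k
  have s: "s k \<in> opR df g A b (what k)" for k
    unfolding s_def by (rule opE_opT_in_opR[OF sub]) (simp add: what T_opT)
  define \<rho> where "\<rho> k = infdist 0 (opR df g A b (what k))" for k
  have r: "r_KKT df g A b (what k) = ereal (\<rho> k)" for k
    unfolding r_KKT_def \<rho>_def using s by (intro edist_set_eq_infdist) auto
  define c where "c = 2 * onorm (opE A \<sigma>) * sqrt (onorm M) / (1 + \<gamma>) * D"
  have rate: "\<rho> k \<le> c / (real k + 1)" for k
  proof -
    define q where "q = (1 + \<gamma>) * (real k + 1)"
    have q: "0 < q" using assms(15) by (simp add: q_def)
    have E: "0 \<le> onorm (opE A \<sigma>)" "0 \<le> sqrt (onorm M)"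
      using onorm_pos_le[OF bounded_linear_opE] onorm_pos_le[OF bounded_linear_M] by simp_all
    have "\<rho> k \<le> norm (s k)"
      using infdist_le[OF s[of k], of 0] by (simp add: \<rho>_def)
    also have "\<dots> \<le> onorm (opE A \<sigma>) * norm (M (w k - what k))"
      unfolding s_def linear_diff[OF linear_M] by (rule onorm[OF bounded_linear_opE])
    also have "\<dots> \<le> onorm (opE A \<sigma>) * (sqrt (onorm M) * seminorm_of M (w k - what k))"
      by (intro mult_left_mono norm_M_le E)
    also have "\<dots> \<le> onorm (opE A \<sigma>) * (sqrt (onorm M) * (2 * D / q))"
      using residual_rate[OF p(1), of k] q assms(17)
      by (intro mult_left_mono E) (simp add: what D_def q_def pos_le_divide_eq mult.commute)
    also have "\<dots> = c / (real k + 1)" by (simp add: c_def q_def)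
    finally show ?thesis .
  qed
  have \<rho>0: "0 \<le> \<rho> k" for k by (simp add: \<rho>_def infdist_nonneg)

  \<comment> \<open>Gap of the objective values\<close>
  have sol: "A *v xs = b" "transpose A *v ys \<in> subdiff \<Phi> xs"
    using pS unfolding S_def xy zeros_opT by simp_all
  obtain \<phi>s where \<phi>s: "\<Phi> xs = ereal \<phi>s" using subdiff_finite[OF sol(2)] .
  \<comment> \<open>Resolvent values carry a subgradient, so the objective is finite there.\<close>
  have "\<exists>a. \<Phi> (fst (what k)) = ereal a" for k
  proof -
    obtain x y where "what k = (x, y)" by (cases "what k")
    then obtain u where "u \<in> subdiff \<Phi> (fst (what k))"
      using T_opT[of "w k"] by (auto simp: what[symmetric] opT_def)
    then show ?thesis using subdiff_finite by metis
  qed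
  then obtain \<phi> where \<phi>: "\<And>k. \<Phi> (fst (what k)) = ereal (\<phi> k)" by metis
  have gap_abs: "\<bar>\<Phi> (fst (what k)) - \<Phi> xs\<bar> = ereal \<bar>\<phi> k - \<phi>s\<bar>" for k
    by (simp add: \<phi> \<phi>s)

  \<comment> \<open>\<open>h\<close> converges and is therefore bounded, which makes the supremum,
    and with it the constant, a real number.\<close>
  define h where "h k = norm (fst (what k) - xs) + norm (snd (what k))" for k
  have "h \<longlonglongrightarrow> norm (xs - xs) + norm ys"
    unfolding h_def using tendsto_fst[OF lim] tendsto_snd[OF lim] unfolding xy fst_conv snd_conv
    by (intro tendsto_intros)
  then have "Bseq h" using convergent_imp_Bseq convergentI by blast
  then obtain B where B: "\<And>k. h k \<le> B" by (auto simp: Bseq_def) (metis abs_le_D1)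
  have "(SUP k. ereal (h k)) \<le> ereal B" using B by (intro SUP_least) simp
  moreover have h_le: "ereal (h k) \<le> (SUP k. ereal (h k))" for k by (rule SUP_upper) simp
  ultimately obtain H where H: "(SUP k. ereal (h k)) = ereal H"
    using h_le[of 0] by (cases "SUP k. ereal (h k)") auto
  define C where "C = H + norm ys"
  have hC: "h k + norm ys \<le> C" for k using h_le[of k] by (simp add: H C_def)
  have "0 \<le> h 0 + norm ys" by (simp add: h_def)
  then have C0: "0 \<le> C" using hC[of 0] by linarith
  have gap: "\<bar>\<phi> k - \<phi>s\<bar> \<le> C * \<rho> k" for k
    unfolding \<rho>_def
  proof (rule mult_infdist_ge)
    show "opR df g A b (what k) \<noteq> {}" using s by blast
    fix r
    assume r: "r \<in> opR df g A b (what k)"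
    obtain x y where wk: "what k = (x, y)" by (cases "what k")
    obtain u where u: "u \<in> subdiff g x" "r = (df x + u - transpose A *v y, A *v x - b)"
      using r unfolding wk by (auto simp: opR_def)
    \<comment> \<open>By the sum rule \<open>df x + u\<close> is a subgradient of
      \<open>\<Phi>\<close>, so \<open>objective_gap\<close> applies to an arbitrary residual vector
      \<open>r\<close>.\<close>
    have "\<bar>\<phi> k - \<phi>s\<bar> \<le> (norm (x - xs) + norm y + norm ys) * norm r"
      unfolding u(2) using u(1) \<phi>[of k]
      by (intro objective_gap[where \<Phi> = \<Phi>] \<phi>s sol) (simp_all add: sub wk)
    also have "\<dots> \<le> C * norm r"
      using hC[of k] by (intro mult_right_mono) (simp_all add: h_def wk)
    finally show "\<bar>\<phi> k - \<phi>s\<bar> \<le> C * dist 0 r" by simp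
  qed (rule C0)
  have gap_rate: "\<bar>\<phi> k - \<phi>s\<bar> \<le> (C * c) / (real k + 1)" for k
    using gap[of k] mult_left_mono[OF rate[of k] C0] by simp

  have rate': "r_KKT df g A b (what k) \<le>
    ereal (2 * onorm (opE A \<sigma>) * sqrt (onorm M) / ((1 + \<gamma>) * (real k + 1))) * semidist_set M w0 S" for k
    using rate[of k] by (simp add: r D c_def)
  have big1: "(\<lambda>k. real_of_ereal (r_KKT df g A b (what k))) \<in> O(\<lambda>k. 1 / real k)"
    using bigo_inverse_nat[OF \<rho>0 rate] by (simp add: r)
  have big2: "(\<lambda>k. real_of_ereal \<bar>\<Phi> (fst (what k)) - \<Phi> xs\<bar>) \<in> O(\<lambda>k. 1 / real k)"
    unfolding gap_abs real_of_ereal.simps by (rule bigo_inverse_nat[OF _ gap_rate]) simp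
  have bound: "let C = (SUP k. ereal (norm (fst (what k) - xs) + norm (snd (what k)))) + ereal (norm ys)
       in C < \<infinity> \<and> (\<forall>k. \<bar>\<Phi> (fst (what k)) - \<Phi> xs\<bar> \<le> C * r_KKT df g A b (what k))"
    unfolding h_def[symmetric] H Let_def using gap by (simp add: gap_abs r C_def)
  show ?thesis
    unfolding defs S_def[symmetric]
    using p(2) lim pS SR rate' big1 big2 bound unfolding xy by blast
qed

end
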